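(* Let $g$ be the Kerr-(anti-)de Sitter metric with real parameters $a,\Lambda$ and $m>0$ (see context). Then the differential curvature invariant $$Q_3=\frac{1}{6\sqrt3}\,\frac{I_5+I_6}{(I_1^2+I_2^2)^{5/4}}$$ of $g$ equals $$Q_3=\frac{-\Lambda a^4\cos^4\theta-3a^2\cos^2\theta+\Lambda a^4\cos^2\theta-\Lambda a^2r^2+6a^2-\Lambda r^4-6mr+3r^2}{6m\sqrt{r^2+a^2\cos^2\theta}}.$$
   Context: Kerr-(anti-)de Sitter metric: in coordinates $(t,r,\theta,\phi)$, signature $(-,+,+,+)$, $$ds^2=-\frac{\Delta_r}{\Xi^2\rho^2}(dt-a\sin^2\theta\,d\phi)^2+\frac{\rho^2}{\Delta_r}dr^2+\frac{\rho^2}{\Delta_\theta}d\theta^2+\frac{\Delta_\theta\sin^2\theta}{\Xi^2\rho^2}\big(a\,dt-(r^2+a^2)d\phi\big)^2,$$ $\Delta_\theta=1+\frac{a^2\Lambda}{3}\cos^2\theta$, $\Xi=1+\frac{a^2\Lambda}{3}$, $\Delta_r=(1-\frac{\Lambda}{3}r^2)(r^2+a^2)-2mr$, $\rho^2=r^2+a^2\cos^2\theta$, on the domain where the metric is regular ($\rho^2\neq0$, $\Delta_r\ne0$, $\Delta_\theta>0$, $\Xi\neq0$, $\sin\theta\ne0$). With $C_{\alpha\beta\gamma\delta}$ the Weyl tensor and $C^*_{\alpha\beta\gamma\delta}=\frac12E_{\alpha\beta\kappa\lambda}C^{\kappa\lambda}{}_{\gamma\delta}$ its dual ($E$ the Levi-Civita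 pseudotensor; $Q_3$ does not depend on orientation): $I_1=C_{\alpha\beta\gamma\delta}C^{\alpha\beta\gamma\delta}$, $I_2=C^*_{\alpha\beta\gamma\delta}C^{\alpha\beta\gamma\delta}$, $k_\mu=-\nabla_\mu I_1$, $l_\mu=-\nabla_\mu I_2$, $I_5=k_\mu k^\mu$, $I_6=l_\mu l^\mu$. *)

theory Defs
  imports "HOL-Analysis.Analysis"
begin

section \<open>Curvature of a metric given in a coordinate chart\<close>

text \<open>
  A metric is given by its component matrix as a function of the coordinates, and tensors by
  their components.  Argument order is index order; suffixes tell which indices are up
  or down (\<open>u\<close> / \<open>d\<close>).
\<close>

type_synonym 'n metric = "real ^ 'n \<Rightarrow> real ^ 'n ^ 'n"

definition partial :: "'n::finite \<Rightarrow> (real ^ 'n \<Rightarrow> real) \<Rightarrow> real ^ 'n \<Rightarrow> real" where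
  "partial i f x = deriv (\<lambda>h. f (x + h *\<^sub>R axis i 1)) 0"

definition inv_metric :: "'n::finite metric \<Rightarrow> 'n metric" where
  "inv_metric g x = matrix_inv (g x)"

definition christoffel :: "'n::finite metric \<Rightarrow> real ^ 'n \<Rightarrow> 'n \<Rightarrow> 'n \<Rightarrow> 'n \<Rightarrow> real" where
  "christoffel g x k i j =
     (1/2) * (\<Sum>l\<in>UNIV. inv_metric g x $ k $ l *
        (partial i (\<lambda>y. g y $ j $ l) x + partial j (\<lambda>y. g y $ i $ l) x
           - partial l (\<lambda>y. g y $ i $ j) x))"

text \<open>
  \<open>riemann_uddd g x a b c d\<close> is the component \<open>R^a_(bcd)\<close> of
  \<open>R(\<partial>_c, \<partial>_d) \<partial>_b = \<nabla>_c \<nabla>_d \<partial>_b - \<nabla>_d \<nabla>_c \<partial>_b\<close>; the Ricci tensor is \<open>R_(bd) = R^a_(bad)\<close>.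
\<close>

definition riemann_uddd ::
  "'n::finite metric \<Rightarrow> real ^ 'n \<Rightarrow> 'n \<Rightarrow> 'n \<Rightarrow> 'n \<Rightarrow> 'n \<Rightarrow> real" where
  "riemann_uddd g x a b c d =
     partial c (\<lambda>y. christoffel g y a d b) x - partial d (\<lambda>y. christoffel g y a c b) x
     + (\<Sum>e\<in>UNIV. christoffel g x a c e * christoffel g x e d b)
     - (\<Sum>e\<in>UNIV. christoffel g x a d e * christoffel g x e c b)"

definition riemann ::
  "'n::finite metric \<Rightarrow> real ^ 'n \<Rightarrow> 'n \<Rightarrow> 'n \<Rightarrow> 'n \<Rightarrow> 'n \<Rightarrow> real" where
  "riemann g x a b c d = (\<Sum>e\<in>UNIV. g x $ a $ e * riemann_uddd g x e b c d)"

definition ricci :: "'n::finite metric \<Rightarrow> real ^ 'n \<Rightarrow> 'n \<Rightarrow> 'n \<Rightarrow> real" where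
  "ricci g x b d = (\<Sum>a\<in>UNIV. riemann_uddd g x a b a d)"

definition scalar_curvature :: "'n::finite metric \<Rightarrow> real ^ 'n \<Rightarrow> real" where
  "scalar_curvature g x = (\<Sum>b\<in>UNIV. \<Sum>d\<in>UNIV. inv_metric g x $ b $ d * ricci g x b d)"

definition weyl ::
  "'n::finite metric \<Rightarrow> real ^ 'n \<Rightarrow> 'n \<Rightarrow> 'n \<Rightarrow> 'n \<Rightarrow> 'n \<Rightarrow> real" where
  "weyl g x a b c d =
     riemann g x a b c d
     - 1 / (real CARD('n) - 2) *
         (g x $ a $ c * ricci g x b d - g x $ a $ d * ricci g x b c
          - g x $ b $ c * ricci g x a d + g x $ b $ d * ricci g x a c)
     + scalar_curvature g x / ((real CARD('n) - 1) * (real CARD('n) - 2)) *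
         (g x $ a $ c * g x $ b $ d - g x $ a $ d * g x $ b $ c)"

definition weyl_uudd ::
  "'n::finite metric \<Rightarrow> real ^ 'n \<Rightarrow> 'n \<Rightarrow> 'n \<Rightarrow> 'n \<Rightarrow> 'n \<Rightarrow> real" where
  "weyl_uudd g x a b c d =
     (\<Sum>e\<in>UNIV. \<Sum>f\<in>UNIV. inv_metric g x $ a $ e * inv_metric g x $ b $ f * weyl g x e f c d)"

definition weyl_uuuu ::
  "'n::finite metric \<Rightarrow> real ^ 'n \<Rightarrow> 'n \<Rightarrow> 'n \<Rightarrow> 'n \<Rightarrow> 'n \<Rightarrow> real" where
  "weyl_uuuu g x a b c d =
     (\<Sum>e\<in>UNIV. \<Sum>f\<in>UNIV. inv_metric g x $ c $ e * inv_metric g x $ d $ f * weyl_uudd g x a b e f)"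

section \<open>Dual Weyl tensor and invariants in dimension four\<close>

text \<open>
  The determinant of the matrix with rows \<open>e_a, e_b, e_c, e_d\<close> is the permutation symbol:
  the sign of \<open>(a, b, c, d)\<close> as a permutation of \<open>(1, 2, 3, 4)\<close>, and \<open>0\<close> if an index repeats.
\<close>

definition permutation_symbol :: "4 \<Rightarrow> 4 \<Rightarrow> 4 \<Rightarrow> 4 \<Rightarrow> real" where
  "permutation_symbol a b c d = det (vector [axis a 1, axis b 1, axis c 1, axis d 1] :: real^4^4)"

definition levi_civita :: "4 metric \<Rightarrow> real^4 \<Rightarrow> 4 \<Rightarrow> 4 \<Rightarrow> 4 \<Rightarrow> 4 \<Rightarrow> real" where
  "levi_civita g x a b c d = sqrt \<bar>det (g x)\<bar> * permutation_symbol a b c d"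

definition dual_weyl :: "4 metric \<Rightarrow> real^4 \<Rightarrow> 4 \<Rightarrow> 4 \<Rightarrow> 4 \<Rightarrow> 4 \<Rightarrow> real" where
  "dual_weyl g x a b c d =
     (1/2) * (\<Sum>e\<in>UNIV. \<Sum>f\<in>UNIV. levi_civita g x a b e f * weyl_uudd g x e f c d)"

definition I1 :: "4 metric \<Rightarrow> real^4 \<Rightarrow> real" where
  "I1 g x = (\<Sum>a\<in>UNIV. \<Sum>b\<in>UNIV. \<Sum>c\<in>UNIV. \<Sum>d\<in>UNIV. weyl g x a b c d * weyl_uuuu g x a b c d)"

definition I2 :: "4 metric \<Rightarrow> real^4 \<Rightarrow> real" where
  "I2 g x = (\<Sum>a\<in>UNIV. \<Sum>b\<in>UNIV. \<Sum>c\<in>UNIV. \<Sum>d\<in>UNIV. dual_weyl g x a b c d * weyl_uuuu g x a b c d)"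

text \<open>On scalars the covariant derivative is the partial derivative.\<close>

definition k_covector :: "4 metric \<Rightarrow> real^4 \<Rightarrow> 4 \<Rightarrow> real" where
  "k_covector g x \<mu> = - partial \<mu> (I1 g) x"

definition l_covector :: "4 metric \<Rightarrow> real^4 \<Rightarrow> 4 \<Rightarrow> real" where
  "l_covector g x \<mu> = - partial \<mu> (I2 g) x"

definition I5 :: "4 metric \<Rightarrow> real^4 \<Rightarrow> real" where
  "I5 g x = (\<Sum>\<mu>\<in>UNIV. \<Sum>\<nu>\<in>UNIV. inv_metric g x $ \<mu> $ \<nu> * k_covector g x \<mu> * k_covector g x \<nu>)"

definition I6 :: "4 metric \<Rightarrow> real^4 \<Rightarrow> real" where
  "I6 g x = (\<Sum>\<mu>\<in>UNIV. \<Sum>\<nu>\<in>UNIV. inv_metric g x $ \<mu> $ \<nu> * l_covector g x \<mu> * l_covector g x \<nu>)"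

definition Q3 :: "4 metric \<Rightarrow> real^4 \<Rightarrow> real" where
  "Q3 g x = 1 / (6 * sqrt 3) * ((I5 g x + I6 g x) / ((I1 g x)\<^sup>2 + (I2 g x)\<^sup>2) powr (5/4))"

section \<open>The Kerr-(anti-)de Sitter metric\<close>

definition Xi :: "real \<Rightarrow> real \<Rightarrow> real" where
  "Xi a \<Lambda> = 1 + a\<^sup>2 * \<Lambda> / 3"

definition Delta_theta :: "real \<Rightarrow> real \<Rightarrow> real \<Rightarrow> real" where
  "Delta_theta a \<Lambda> \<theta> = 1 + a\<^sup>2 * \<Lambda> / 3 * (cos \<theta>)\<^sup>2"

definition Delta_r :: "real \<Rightarrow> real \<Rightarrow> real \<Rightarrow> real \<Rightarrow> real" where
  "Delta_r a \<Lambda> m r = (1 - \<Lambda> / 3 * r\<^sup>2) * (r\<^sup>2 + a\<^sup>2) - 2 * m * r"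

definition rho_sq :: "real \<Rightarrow> real \<Rightarrow> real \<Rightarrow> real" where
  "rho_sq a r \<theta> = r\<^sup>2 + a\<^sup>2 * (cos \<theta>)\<^sup>2"

text \<open>
  The coordinates \<open>(t, r, \<theta>, \<phi>)\<close> have indices \<open>1, 2, 3, 4\<close>.  In the line element, \<open>\<alpha>\<close> and \<open>\<beta>\<close> are
  the 1-forms \<open>dt - a sin^2 \<theta> d\<phi>\<close> and \<open>a dt - (r^2 + a^2) d\<phi>\<close>.
\<close>

definition kerr_ads :: "real \<Rightarrow> real \<Rightarrow> real \<Rightarrow> 4 metric" where
  "kerr_ads a \<Lambda> m x =
    (let r = x $ 2; \<theta> = x $ 3;
         dt = axis 1 1; dr = axis 2 1; d\<theta> = axis 3 1; d\<phi> = axis 4 1 :: real^4;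
         \<alpha> = dt - (a * (sin \<theta>)\<^sup>2) *\<^sub>R d\<phi>;
         \<beta> = a *\<^sub>R dt - (r\<^sup>2 + a\<^sup>2) *\<^sub>R d\<phi>
     in \<chi> i j.
          - (Delta_r a \<Lambda> m r / ((Xi a \<Lambda>)\<^sup>2 * rho_sq a r \<theta>)) * \<alpha> $ i * \<alpha> $ j
          + rho_sq a r \<theta> / Delta_r a \<Lambda> m r * dr $ i * dr $ j
          + rho_sq a r \<theta> / Delta_theta a \<Lambda> \<theta> * d\<theta> $ i * d\<theta> $ j
          + Delta_theta a \<Lambda> \<theta> * (sin \<theta>)\<^sup>2 / ((Xi a \<Lambda>)\<^sup>2 * rho_sq a r \<theta>) * \<beta> $ i * \<beta> $ j)"

end

(*
  In the Carter coframe (dt - a sin^2 theta dphi)/Xi, dr, d(cos theta), (a dt - (r^2 + a^2) dphi)/Xi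
  the metric is diagonal and the connection is a table of rational functions.  Being metric and
  torsion free, it is the Levi-Civita connection, and Cartan's second structure equation gives the
  curvature: Lambda/3 times that of a space form plus a type D Weyl tensor with complex scalar
  Z = X + iY = m / zeta^3, zeta = r - i a cos theta.  Hence I_1 and, up to sign, I_2 are the real and
  imaginary parts of 48 Z^2 = 48 m^2 / zeta^6.  As zeta depends only on r and cos theta, the sum
  I_5 + I_6 is the squared length of the complex gradient of 48 Z^2, that is
  (288 m^2)^2 (Delta_r + a^2 sin^2 theta Delta_theta) / rho^16, whereas
  I_1^2 + I_2^2 = (48 m^2)^2 / rho^12.
*)
theory Submission
  imports Defs
begin

subsection \<open>Linear maps acting on the slots of a tensor\<close>

text \<open>Expanding 256 coordinate components of the curvature is out of reach. Changes of frame
  therefore stay symbolic, as matrices acting on single slots, and only the tables in the frame are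
  expanded. The coframe is left unnormalised: unit vectors would bring in sqrt |Delta_r| and a case
  split on the sign of Delta_r. Instead the squared lengths multiply in pairs to -1 and 1, which is
  all that the algebra of the Weyl tensor uses. With d(cos theta) in place of d theta, and u + i v =
  1/zeta, the derivatives of u and v are again polynomials in a, u, v, so the tables of derivatives
  stay rational in the same symbols. Delta_r and Delta_theta sin^2 theta are independent symbols in
  the curvature computation; their formulas matter there only when the result is compared with a
  type D tensor. Curvature and gradients are derivatives, so the Christoffel symbols and the
  invariants have to be known on an open set, not just at one point. The volume form sees only |det
  E|, and the sign of sin theta is not fixed: I_2 thus carries a locally constant sign, which
  disappears on squaring.\<close>

lemma matrix_diff_ldistrib: "(A::real^'n^'m) ** (B - C) = A ** B - A ** C"
  by (simp add: matrix_matrix_mult_def vec_eq_iff right_diff_distrib sum_subtractf)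

lemma matrix_diff_rdistrib: "(B - C) ** (A::real^'n^'m) = B ** A - C ** A"
  by (simp add: matrix_matrix_mult_def vec_eq_iff left_diff_distrib sum_subtractf)

lemma matrix_add_rdistrib: "(B + C) ** (A::real^'n^'m) = B ** A + C ** A"
  by (simp add: matrix_matrix_mult_def vec_eq_iff distrib_right sum.distrib)

lemma matrix_minus_left: "(- B) ** (A::real^'n^'m) = - (B ** A)"
  by (simp add: matrix_matrix_mult_def vec_eq_iff sum_negf)

lemmas matrix_algebra = matrix_diff_ldistrib matrix_diff_rdistrib matrix_add_ldistrib
  matrix_add_rdistrib matrix_minus_left matrix_mul_assoc

lemma matrix_inv_eqI:
  fixes A B :: "'a::field^'n^'n"
  assumes "B ** A = mat 1"
  shows "matrix_inv A = B"
proof -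
  have AB: "A ** B = mat 1" using assms matrix_left_right_inverse by blast
  have "A ** matrix_inv A = mat 1 \<and> matrix_inv A ** A = mat 1"
    unfolding matrix_inv_def by (rule someI[of _ B]) (simp add: assms AB)
  then show ?thesis
    by (metis AB assms matrix_mul_assoc matrix_mul_lid matrix_mul_rid)
qed

lemma transpose_plus: "transpose (A + B) = transpose A + transpose (B :: real^'n^'m)"
  by (simp add: transpose_def vec_eq_iff)

type_synonym 'n tensor4 = "'n \<Rightarrow> 'n \<Rightarrow> 'n \<Rightarrow> 'n \<Rightarrow> real"

definition act1 :: "real^'n^'n \<Rightarrow> 'n::finite tensor4 \<Rightarrow> 'n tensor4" where
  "act1 A T a b c d = (\<Sum>p\<in>UNIV. A $ a $ p * T p b c d)"
definition act2 :: "real^'n^'n \<Rightarrow> 'n::finite tensor4 \<Rightarrow> 'n tensor4" where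
  "act2 A T a b c d = (\<Sum>p\<in>UNIV. A $ b $ p * T a p c d)"
definition act3 :: "real^'n^'n \<Rightarrow> 'n::finite tensor4 \<Rightarrow> 'n tensor4" where
  "act3 A T a b c d = (\<Sum>p\<in>UNIV. A $ c $ p * T a b p d)"
definition act4 :: "real^'n^'n \<Rightarrow> 'n::finite tensor4 \<Rightarrow> 'n tensor4" where
  "act4 A T a b c d = (\<Sum>p\<in>UNIV. A $ d $ p * T a b c p)"

lemmas act_defs = act1_def act2_def act3_def act4_def

text \<open>Each slot has its own matrix because upper and lower indices transform differently: a
  covariant tensor takes \<open>transpose E\<close> in every slot, an upper index takes
  \<open>F\<close>.\<close>

definition act :: "real^'n^'n \<Rightarrow> real^'n^'n \<Rightarrow> real^'n^'n \<Rightarrow> real^'n^'n \<Rightarrow> 'n::finite tensor4 \<Rightarrow> 'n tensor4" where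
  "act A B C D T = act1 A (act2 B (act3 C (act4 D T)))"

lemma act_slot_commute:
  "act2 B (act1 A T) = act1 A (act2 B T)" "act3 B (act1 A T) = act1 A (act3 B T)"
  "act4 B (act1 A T) = act1 A (act4 B T)" "act3 B (act2 A T) = act2 A (act3 B T)"
  "act4 B (act2 A T) = act2 A (act4 B T)" "act4 B (act3 A T) = act3 A (act4 B T)"
  by (auto intro!: ext simp: act_defs sum_distrib_left mult.left_commute intro: sum.swap)

lemma act_slot_mult:
  "act1 A (act1 B T) = act1 (A ** B) T" "act2 A (act2 B T) = act2 (A ** B) T"
  "act3 A (act3 B T) = act3 (A ** B) T" "act4 A (act4 B T) = act4 (A ** B) T"
  by (auto intro!: ext simp: act_defs matrix_matrix_mult_def sum_distrib_left sum_distrib_right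
      mult.assoc intro: sum.swap)

lemma act_slot_id [simp]: "act1 (mat 1) T = T" "act2 (mat 1) T = T" "act3 (mat 1) T = T" "act4 (mat 1) T = T"
  by (auto intro!: ext simp: act_defs mat_def if_distrib[of "\<lambda>z. z * _"] cong: if_cong)

text \<open>Matrices in different slots commute, so composition is slotwise. This cancels
  \<open>E\<close> against \<open>F\<close> without expanding any fourfold sum.\<close>

lemma act_act: "act A B C D (act A' B' C' D' T) = act (A ** A') (B ** B') (C ** C') (D ** D') T"
  by (simp add: act_def act_slot_commute act_slot_mult)

lemma act_id [simp]: "act (mat 1) (mat 1) (mat 1) (mat 1) T = T"
  by (simp add: act_def)

lemma act_expand:
  "act A B C D T a b c d = (\<Sum>p\<in>UNIV. \<Sum>q\<in>UNIV. \<Sum>r\<in>UNIV. \<Sum>s\<in>UNIV. A $ a $ p * B $ b $ q * C $ c $ r * D $ d $ s * T p q r s)"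
  by (simp add: act_def act_defs sum_distrib_left mult.assoc)

lemma act_add: "act A B C D (\<lambda>a b c d. T a b c d + U a b c d) a b c d = act A B C D T a b c d + act A B C D U a b c d"
  by (simp add: act_expand distrib_left sum.distrib)

lemma act_diff: "act A B C D (\<lambda>a b c d. T a b c d - U a b c d) a b c d = act A B C D T a b c d - act A B C D U a b c d"
  by (simp add: act_expand right_diff_distrib sum_subtractf)

lemma act_scale: "act A B C D (\<lambda>a b c d. k * T a b c d) a b c d = k * act A B C D T a b c d"
  by (simp add: act_expand sum_distrib_left mult.left_commute)

section \<open>Full contractions, traces and their frame independence\<close>

definition contract :: "'n::finite tensor4 \<Rightarrow> 'n tensor4 \<Rightarrow> real" where
  "contract T U = (\<Sum>a\<in>UNIV. \<Sum>b\<in>UNIV. \<Sum>c\<in>UNIV. \<Sum>d\<in>UNIV. T a b c d * U a b c d)"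

text \<open>Brings the index of one chosen slot to the innermost sum, where
  \<open>sum_adjoint\<close> applies.\<close>

lemma sum_quad_inner:
  fixes f :: "'n::finite \<Rightarrow> 'n \<Rightarrow> 'n \<Rightarrow> 'n \<Rightarrow> real"
  shows "(\<Sum>a\<in>UNIV. \<Sum>b\<in>UNIV. \<Sum>c\<in>UNIV. \<Sum>d\<in>UNIV. f a b c d) = (\<Sum>b\<in>UNIV. \<Sum>c\<in>UNIV. \<Sum>d\<in>UNIV. \<Sum>a\<in>UNIV. f a b c d)"
    and "(\<Sum>a\<in>UNIV. \<Sum>b\<in>UNIV. \<Sum>c\<in>UNIV. \<Sum>d\<in>UNIV. f a b c d) = (\<Sum>a\<in>UNIV. \<Sum>c\<in>UNIV. \<Sum>d\<in>UNIV. \<Sum>b\<in>UNIV. f a b c d)"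
    and "(\<Sum>a\<in>UNIV. \<Sum>b\<in>UNIV. \<Sum>c\<in>UNIV. \<Sum>d\<in>UNIV. f a b c d) = (\<Sum>a\<in>UNIV. \<Sum>b\<in>UNIV. \<Sum>d\<in>UNIV. \<Sum>c\<in>UNIV. f a b c d)"
proof -
  have 3: "(\<Sum>b\<in>UNIV. \<Sum>c\<in>UNIV. g b c) = (\<Sum>c\<in>UNIV. \<Sum>b\<in>UNIV. g b c)" for g :: "'n \<Rightarrow> 'n \<Rightarrow> real"
    by (rule sum.swap)
  have 2: "(\<Sum>b\<in>UNIV. \<Sum>c\<in>UNIV. \<Sum>d\<in>UNIV. g b c d) = (\<Sum>c\<in>UNIV. \<Sum>d\<in>UNIV. \<Sum>b\<in>UNIV. g b c d)"
    for g :: "'n \<Rightarrow> 'n \<Rightarrow> 'n \<Rightarrow> real"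
    by (subst 3) (rule sum.cong[OF refl 3])
  show "(\<Sum>a\<in>UNIV. \<Sum>b\<in>UNIV. \<Sum>c\<in>UNIV. \<Sum>d\<in>UNIV. f a b c d) = (\<Sum>b\<in>UNIV. \<Sum>c\<in>UNIV. \<Sum>d\<in>UNIV. \<Sum>a\<in>UNIV. f a b c d)"
    by (subst 3) (rule sum.cong[OF refl 2])
  show "(\<Sum>a\<in>UNIV. \<Sum>b\<in>UNIV. \<Sum>c\<in>UNIV. \<Sum>d\<in>UNIV. f a b c d) = (\<Sum>a\<in>UNIV. \<Sum>c\<in>UNIV. \<Sum>d\<in>UNIV. \<Sum>b\<in>UNIV. f a b c d)"
    by (rule sum.cong[OF refl 2])
  show "(\<Sum>a\<in>UNIV. \<Sum>b\<in>UNIV. \<Sum>c\<in>UNIV. \<Sum>d\<in>UNIV. f a b c d) = (\<Sum>a\<in>UNIV. \<Sum>b\<in>UNIV. \<Sum>d\<in>UNIV. \<Sum>c\<in>UNIV. f a b c d)"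
    by (intro sum.cong refl 3)
qed

lemma sum_adjoint:
  fixes A :: "real^'n^'n"
  shows "(\<Sum>d\<in>UNIV. (\<Sum>p\<in>UNIV. A $ d $ p * t p) * u d) = (\<Sum>p\<in>UNIV. t p * (\<Sum>d\<in>UNIV. transpose A $ p $ d * u d))"
proof -
  have "(\<Sum>d\<in>UNIV. (\<Sum>p\<in>UNIV. A $ d $ p * t p) * u d) = (\<Sum>d\<in>UNIV. \<Sum>p\<in>UNIV. A $ d $ p * t p * u d)"
    by (simp add: sum_distrib_right)
  also have "\<dots> = (\<Sum>p\<in>UNIV. \<Sum>d\<in>UNIV. A $ d $ p * t p * u d)"
    by (rule sum.swap)
  finally show ?thesis
    by (simp add: sum_distrib_left transpose_def mult_ac)
qed

lemma contract_adjoint: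
  "contract (act1 A T) U = contract T (act1 (transpose A) U)"
  "contract (act2 A T) U = contract T (act2 (transpose A) U)"
  "contract (act3 A T) U = contract T (act3 (transpose A) U)"
  "contract (act4 A T) U = contract T (act4 (transpose A) U)"
  unfolding contract_def act_defs
  subgoal by (subst (1 2) sum_quad_inner(1)) (simp only: sum_adjoint)
  subgoal by (subst (1 2) sum_quad_inner(2)) (simp only: sum_adjoint)
  subgoal by (subst (1 2) sum_quad_inner(3)) (simp only: sum_adjoint)
  subgoal by (simp only: sum_adjoint)
  done

lemma contract_act:
  "contract (act A B C D T) U = contract T (act (transpose A) (transpose B) (transpose C) (transpose D) U)"
  by (simp add: act_def contract_adjoint act_slot_commute)

lemma contract_act_dual:
  assumes "B ** A = mat 1"
  shows "contract (act (transpose B) (transpose B) (transpose B) (transpose B) T) (act A A A A U) = contract T U"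
  by (simp add: contract_act act_act assms)

text \<open>One traced index is contravariant and the other covariant, so their matrices meet as
  \<open>C ** A\<close> and cancel. This is what allows the Ricci tensor to be traced in the
  frame.\<close>

lemma trace_act:
  fixes A :: "real^'n^'n"
  assumes "C ** A = mat 1"
  shows "(\<Sum>a\<in>UNIV. act A B (transpose C) D T a b a d) =
    (\<Sum>q\<in>UNIV. \<Sum>s\<in>UNIV. B $ b $ q * D $ d $ s * (\<Sum>p\<in>UNIV. T p q p s))"
proof -
  define V where "V = act2 B (act4 D T)"
  have "act A B (transpose C) D T = act1 A (act3 (transpose C) V)"
    by (simp add: act_def V_def act_slot_commute)
  then have "(\<Sum>a\<in>UNIV. act A B (transpose C) D T a b a d) =
      (\<Sum>a\<in>UNIV. \<Sum>p\<in>UNIV. A $ a $ p * (\<Sum>r\<in>UNIV. C $ r $ a * V p b r d))"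
    by (simp add: act_defs transpose_def)
  also have "\<dots> = (\<Sum>p\<in>UNIV. \<Sum>a\<in>UNIV. \<Sum>r\<in>UNIV. A $ a $ p * (C $ r $ a * V p b r d))"
    by (subst sum.swap) (simp add: sum_distrib_left)
  also have "\<dots> = (\<Sum>p\<in>UNIV. \<Sum>r\<in>UNIV. (C ** A) $ r $ p * V p b r d)"
  proof (rule sum.cong[OF refl])
    fix p
    show "(\<Sum>a\<in>UNIV. \<Sum>r\<in>UNIV. A $ a $ p * (C $ r $ a * V p b r d)) = (\<Sum>r\<in>UNIV. (C ** A) $ r $ p * V p b r d)"
      by (subst sum.swap) (simp add: matrix_matrix_mult_def sum_distrib_left sum_distrib_right mult_ac)
  qed
  also have "\<dots> = (\<Sum>p\<in>UNIV. V p b p d)"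
    by (simp add: assms mat_def if_distrib[of "\<lambda>z. z * _"] cong: if_cong)
  also have "\<dots> = (\<Sum>p\<in>UNIV. \<Sum>q\<in>UNIV. \<Sum>s\<in>UNIV. B $ b $ q * (D $ d $ s * T p q p s))"
    by (simp add: V_def act_defs sum_distrib_left)
  also have "\<dots> = (\<Sum>q\<in>UNIV. \<Sum>s\<in>UNIV. \<Sum>p\<in>UNIV. B $ b $ q * (D $ d $ s * T p q p s))"
    by (subst sum.swap) (rule sum.cong[OF refl sum.swap])
  finally show ?thesis
    by (simp add: sum_distrib_left mult.assoc)
qed

subsection \<open>Partial derivatives\<close>

text \<open>Unlike \<open>partial\<close>, which rests on \<open>deriv\<close>, this relation
  carries differentiability and so composes; vector values allow the product rule for whole
  matrices.\<close>

definition has_partial :: "'n \<Rightarrow> (real^'n::finite \<Rightarrow> 'a::real_normed_vector) \<Rightarrow> 'a \<Rightarrow> real^'n \<Rightarrow> bool" where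
  "has_partial i f f' x \<longleftrightarrow> ((\<lambda>h. f (x + h *\<^sub>R axis i 1)) has_vector_derivative f') (at 0)"

lemma has_partial_imp_partial: "has_partial i f f' x \<Longrightarrow> partial i f x = f'"
  unfolding has_partial_def partial_def
  by (intro DERIV_imp_deriv) (simp add: has_real_derivative_iff_has_vector_derivative)

lemma has_partial_const [simp]: "has_partial i (\<lambda>_. c) 0 x"
  by (simp add: has_partial_def)

lemma has_partial_add: "has_partial i f f' x \<Longrightarrow> has_partial i g g' x \<Longrightarrow> has_partial i (\<lambda>y. f y + g y) (f' + g') x"
  unfolding has_partial_def by (rule has_vector_derivative_add)

lemma has_partial_sum: "(\<And>k. k \<in> K \<Longrightarrow> has_partial i (f k) (f' k) x) \<Longrightarrow> has_partial i (\<lambda>y. \<Sum>k\<in>K. f k y) (\<Sum>k\<in>K. f' k) x"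
  unfolding has_partial_def by (rule has_vector_derivative_sum)

lemma has_partial_linear: "bounded_linear L \<Longrightarrow> has_partial i f f' x \<Longrightarrow> has_partial i (\<lambda>y. L (f y)) (L f') x"
  unfolding has_partial_def by (rule bounded_linear.has_vector_derivative)

lemma has_partial_nth: "has_partial i f f' x \<Longrightarrow> has_partial i (\<lambda>y. f y $ k) (f' $ k) x"
  by (rule has_partial_linear[OF bounded_linear_vec_nth])

lemma has_partial_bilinear:
  assumes "bounded_bilinear B" "has_partial i f f' x" "has_partial i g g' x"
  shows "has_partial i (\<lambda>y. B (f y) (g y)) (B f' (g x) + B (f x) g') x"
  using bounded_bilinear.has_vector_derivative[OF assms(1), of "\<lambda>h. f (x + h *\<^sub>R axis i 1)" f' 0 UNIV "\<lambda>h. g (x + h *\<^sub>R axis i 1)" g'] assms(2,3)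
  by (simp add: has_partial_def add.commute)

lemma has_partial_vec:
  fixes f :: "real^'n::finite \<Rightarrow> 'a::euclidean_space^'m"
  assumes "\<And>k. has_partial i (\<lambda>y. f y $ k) (f' $ k) x"
  shows "has_partial i f f' x"
proof -
  have "has_partial i (\<lambda>y. \<Sum>k\<in>UNIV. axis k (f y $ k)) (\<Sum>k\<in>UNIV. axis k (f' $ k)) x"
    by (intro has_partial_sum has_partial_linear[OF _ assms] linear_conv_bounded_linear[THEN iffD1] linearI)
      (simp_all add: axis_def vec_eq_iff)
  moreover have "(\<Sum>k\<in>UNIV. axis k (v $ k)) = v" for v :: "'a^'m"
    by (simp add: vec_eq_iff axis_def if_distrib cong: if_cong)
  ultimately show ?thesis by simp
qed

lemma bounded_bilinear_matrix_mult: "bounded_bilinear ((**) :: real^'n^'m \<Rightarrow> real^'k^'n \<Rightarrow> real^'k^'m)"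
  unfolding bilinear_conv_bounded_bilinear[symmetric] bilinear_def
  by (auto intro!: linearI simp: matrix_add_ldistrib matrix_add_rdistrib scalar_matrix_assoc[symmetric] matrix_scalar_ac)

lemmas has_partial_mult = has_partial_bilinear[OF bounded_bilinear_mult]
  and has_partial_scaleR = has_partial_bilinear[OF bounded_bilinear_scaleR]
  and has_partial_matrix_mult = has_partial_bilinear[OF bounded_bilinear_matrix_mult]

lemma has_partial_transpose:
  fixes f :: "real^'n::finite \<Rightarrow> real^'m^'k"
  shows "has_partial i f f' x \<Longrightarrow> has_partial i (\<lambda>y. transpose (f y)) (transpose f') x"
  by (rule has_partial_linear[OF linear_conv_bounded_linear[THEN iffD1]])
    (auto intro!: linearI simp: transpose_def vec_eq_iff)

lemma eventually_along_axis:
  fixes x :: "real^'n"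
  assumes "open U" "x \<in> U"
  shows "\<forall>\<^sub>F h in nhds (0::real). x + h *\<^sub>R axis i 1 \<in> U"
proof -
  have "open ((\<lambda>h::real. x + h *\<^sub>R axis i 1) -` U)"
    by (intro open_vimage assms continuous_intros)
  then show ?thesis
    using assms by (auto simp: eventually_nhds)
qed

lemma has_partial_cong:
  assumes "open U" "x \<in> U" "\<And>y. y \<in> U \<Longrightarrow> f y = g y"
  shows "has_partial i f f' x \<longleftrightarrow> has_partial i g f' x"
  unfolding has_partial_def
  by (rule has_vector_derivative_cong_ev)
    (use assms eventually_along_axis[OF assms(1,2), of i] in \<open>auto elim: eventually_mono\<close>)

subsection \<open>The Levi-Civita connection and its curvature\<close>

text \<open>Koszul's argument: writing the three derivatives of \<open>g\<close> by
  \<open>compat\<close> gives six terms; by symmetry four cancel and the other two agree.\<close>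

lemma christoffel_unique:
  fixes g :: "'n::finite metric"
  assumes inv: "G ** g x = mat 1" and sym: "\<And>i j. g x $ i $ j = g x $ j $ i"
    and compat: "\<And>i j l. has_partial i (\<lambda>y. g y $ j $ l) (\<Sum>k\<in>UNIV. \<Gamma> k i j * g x $ k $ l + \<Gamma> k i l * g x $ j $ k) x"
    and tors: "\<And>k i j. \<Gamma> k i j = \<Gamma> k j i"
  shows "christoffel g x k i j = \<Gamma> k i j"
proof -
  have G: "inv_metric g x = G"
    unfolding inv_metric_def by (rule matrix_inv_eqI[OF inv])
  have 1: "partial i (\<lambda>y. g y $ j $ l) x + partial j (\<lambda>y. g y $ i $ l) x - partial l (\<lambda>y. g y $ i $ j) x
      = 2 * (\<Sum>k\<in>UNIV. \<Gamma> k i j * g x $ k $ l)" for l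
    unfolding has_partial_imp_partial[OF compat]
    using sym tors by (simp add: sum.distrib algebra_simps sum_distrib_left sum_subtractf)
  have "christoffel g x k i j = (\<Sum>l\<in>UNIV. G $ k $ l * (\<Sum>n\<in>UNIV. \<Gamma> n i j * g x $ n $ l))"
    by (simp add: christoffel_def 1 G sum_distrib_left mult_ac)
  also have "\<dots> = (\<Sum>l\<in>UNIV. \<Sum>n\<in>UNIV. G $ k $ l * g x $ l $ n * \<Gamma> n i j)"
    by (simp add: sum_distrib_left mult_ac sym)
  also have "\<dots> = (\<Sum>n\<in>UNIV. (G ** g x) $ k $ n * \<Gamma> n i j)"
    by (subst sum.swap) (simp add: matrix_matrix_mult_def sum_distrib_right)
  also have "\<dots> = \<Gamma> k i j"
    by (simp add: inv mat_def if_distrib[of "\<lambda>z. z * _"] cong: if_cong)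
  finally show ?thesis .
qed

section \<open>Cartan's structure equations for a moving frame\<close>

lemma matrix_entry_mult: "(A ** B) $ i $ j = (\<Sum>k\<in>UNIV. A $ i $ k * B $ k $ j)"
  by (simp add: matrix_matrix_mult_def)

interpretation mm: bounded_bilinear "(**) :: real^'n^'m \<Rightarrow> real^'k^'n \<Rightarrow> real^'k^'m"
  by (rule bounded_bilinear_matrix_mult)

text \<open>The last sum is the connection evaluated on the Lie bracket of two frame vectors, whose
  components are \<open>w r $ f $ s - w s $ f $ r\<close> when the torsion vanishes.\<close>

definition frame_curvature :: "('n::finite \<Rightarrow> real^'n^'n) \<Rightarrow> ('n \<Rightarrow> 'n \<Rightarrow> real^'n^'n) \<Rightarrow> 'n tensor4" where
  "frame_curvature w dw p q r s =
    (dw r s - dw s r + w r ** w s - w s ** w r - (\<Sum>f\<in>UNIV. (w r $ f $ s - w s $ f $ r) *\<^sub>R w f)) $ p $ q"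

text \<open>
  The rows of \<open>E\<close> are a coframe, \<open>F\<close> holds the dual frame in its columns, and \<open>H\<close> is the Gram matrix
  of the frame.  The connection is given by \<open>\<nabla>\<^sub>c e\<^sub>b = w\<^sub>c\<^sup>a\<^sub>b e\<^sub>a\<close>.  In \<open>dE\<close> and \<open>ddE\<close> the derivatives are
  along coordinates, in \<open>dH\<close> and \<open>dw\<close> along frame vectors, the first index being the direction.
\<close>

locale moving_frame =
  fixes g :: "'n::finite metric" and U :: "(real^'n) set"
    and E F :: "real^'n \<Rightarrow> real^'n^'n" and dE :: "real^'n \<Rightarrow> 'n \<Rightarrow> real^'n^'n"
    and ddE :: "real^'n \<Rightarrow> 'n \<Rightarrow> 'n \<Rightarrow> real^'n^'n"
    and H :: "real^'n \<Rightarrow> real^'n^'n" and dH :: "real^'n \<Rightarrow> 'n \<Rightarrow> real^'n^'n"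
    and w :: "real^'n \<Rightarrow> 'n \<Rightarrow> real^'n^'n" and dw :: "real^'n \<Rightarrow> 'n \<Rightarrow> 'n \<Rightarrow> real^'n^'n"
  assumes open_U: "open U"
    and FE: "y \<in> U \<Longrightarrow> F y ** E y = mat 1"
    and metric: "y \<in> U \<Longrightarrow> g y = transpose (E y) ** H y ** E y"
    and H_sym: "y \<in> U \<Longrightarrow> transpose (H y) = H y"
    and H_inv: "y \<in> U \<Longrightarrow> \<exists>K. K ** H y = mat 1"
    and deriv_E: "y \<in> U \<Longrightarrow> has_partial i E (dE y i) y"
    and deriv_dE: "y \<in> U \<Longrightarrow> has_partial i (\<lambda>y. dE y j) (ddE y i j) y"
    and ddE_sym: "y \<in> U \<Longrightarrow> ddE y i j = ddE y j i"
    and deriv_F: "y \<in> U \<Longrightarrow> has_partial i F (- (F y ** dE y i ** F y)) y"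
    and deriv_H: "y \<in> U \<Longrightarrow> has_partial i H (\<Sum>c\<in>UNIV. E y $ c $ i *\<^sub>R dH y c) y"
    and deriv_w: "y \<in> U \<Longrightarrow> has_partial i (\<lambda>y. w y c) (\<Sum>d\<in>UNIV. E y $ d $ i *\<^sub>R dw y d c) y"
    and compat: "y \<in> U \<Longrightarrow> dH y c = H y ** w y c + transpose (w y c) ** H y"
    and torsion: "y \<in> U \<Longrightarrow> dE y i $ f $ j - dE y j $ f $ i =
      (\<Sum>c\<in>UNIV. \<Sum>d\<in>UNIV. (w y d $ f $ c - w y c $ f $ d) * E y $ c $ i * E y $ d $ j)"
begin

definition \<omega> :: "real^'n \<Rightarrow> 'n \<Rightarrow> real^'n^'n" where
  "\<omega> y i = (\<Sum>c\<in>UNIV. E y $ c $ i *\<^sub>R w y c)"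

text \<open>\<open>F y ** N y i\<close> is the gauge transform of \<open>\<omega> y i\<close> to the
  coordinate basis; \<open>christoffel_frame\<close> identifies it with the Christoffel
  symbols.\<close>

definition N :: "real^'n \<Rightarrow> 'n \<Rightarrow> real^'n^'n" where
  "N y i = dE y i + \<omega> y i ** E y"

lemma EF: "y \<in> U \<Longrightarrow> E y ** F y = mat 1"
  using FE matrix_left_right_inverse by blast

lemma \<omega>_entry: "\<omega> y i $ a $ b = (\<Sum>c\<in>UNIV. E y $ c $ i * w y c $ a $ b)"
  by (simp add: \<omega>_def)

lemma N_sym:
  assumes "y \<in> U"
  shows "N y i $ f $ j = N y j $ f $ i"
proof -
  have 1: "(\<omega> y i ** E y) $ f $ j = (\<Sum>c\<in>UNIV. \<Sum>d\<in>UNIV. w y c $ f $ d * E y $ c $ i * E y $ d $ j)" for i j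
    unfolding matrix_entry_mult \<omega>_entry
    by (subst sum.swap) (simp add: sum_distrib_left sum_distrib_right mult_ac)
  have 2: "(\<omega> y j ** E y) $ f $ i = (\<Sum>c\<in>UNIV. \<Sum>d\<in>UNIV. w y d $ f $ c * E y $ c $ i * E y $ d $ j)"
    unfolding 1 by (subst sum.swap) (simp add: mult_ac)
  show ?thesis
    using torsion[OF assms, of i f j]
    by (simp add: N_def 1[of i j] 2 left_diff_distrib sum_subtractf)
qed

lemma deriv_metric:
  assumes "y \<in> U"
  shows "has_partial i g (transpose (F y ** N y i) ** g y + g y ** (F y ** N y i)) y"
proof -
  have dH': "(\<Sum>c\<in>UNIV. E y $ c $ i *\<^sub>R dH y c) = H y ** \<omega> y i + transpose (\<omega> y i) ** H y"
  proof -
    have 1: "H y ** \<omega> y i = (\<Sum>c\<in>UNIV. E y $ c $ i *\<^sub>R (H y ** w y c))"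
      by (simp add: vec_eq_iff matrix_entry_mult \<omega>_entry sum_distrib_left mult_ac, intro allI sum.swap)
    have 2: "transpose (\<omega> y i) ** H y = (\<Sum>c\<in>UNIV. E y $ c $ i *\<^sub>R (transpose (w y c) ** H y))"
      by (simp add: vec_eq_iff matrix_entry_mult \<omega>_entry transpose_def sum_distrib_left sum_distrib_right mult_ac, intro allI sum.swap)
    show ?thesis
      by (simp add: 1 2 compat[OF assms] sum.distrib scaleR_add_right)
  qed
  have "has_partial i (\<lambda>y. transpose (E y) ** H y ** E y)
     ((transpose (dE y i) ** H y + transpose (E y) ** (H y ** \<omega> y i + transpose (\<omega> y i) ** H y)) ** E y
      + transpose (E y) ** H y ** dE y i) y"
    using has_partial_matrix_mult[OF has_partial_matrix_mult[OF has_partial_transpose[OF deriv_E[OF assms, of i]]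
      deriv_H[OF assms, of i]] deriv_E[OF assms, of i]]
    unfolding dH' .
  also have "(transpose (dE y i) ** H y + transpose (E y) ** (H y ** \<omega> y i + transpose (\<omega> y i) ** H y)) ** E y
      + transpose (E y) ** H y ** dE y i = transpose (N y i) ** H y ** E y + transpose (E y) ** H y ** N y i"
    by (simp add: N_def matrix_algebra matrix_transpose_mul transpose_plus)
  also have "transpose (N y i) ** H y ** E y = transpose (F y ** N y i) ** g y"
    using EF[OF assms] FE[OF assms]
    by (simp add: metric[OF assms] matrix_transpose_mul matrix_mul_assoc)
       (metis matrix_mul_assoc matrix_mul_rid matrix_transpose_mul transpose_mat)
  also have "transpose (E y) ** H y ** N y i = g y ** (F y ** N y i)"
    using EF[OF assms]
    by (simp add: metric[OF assms]) (metis matrix_mul_assoc matrix_mul_rid)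
  finally show ?thesis
    by (subst has_partial_cong[OF open_U assms, of g "\<lambda>y. transpose (E y) ** H y ** E y"]) (simp_all add: metric)
qed

lemma christoffel_frame:
  assumes y: "y \<in> U"
  shows "christoffel g y k i j = (F y ** N y i) $ k $ j"
proof -
  obtain K where K: "K ** H y = mat 1" using H_inv[OF y] by blast
  have sym: "transpose (g y) = g y"
    by (simp add: metric[OF y] matrix_transpose_mul H_sym[OF y] matrix_mul_assoc)
  have inv: "(F y ** K ** transpose (F y)) ** g y = mat 1"
  proof -
    have "(F y ** K ** transpose (F y)) ** g y = F y ** K ** transpose (E y ** F y) ** H y ** E y"
      by (simp add: metric[OF y] matrix_transpose_mul matrix_mul_assoc)
    also have "\<dots> = F y ** (K ** H y) ** E y"
      by (simp add: EF[OF y] matrix_mul_assoc)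
    finally show ?thesis by (simp add: K FE[OF y])
  qed
  show ?thesis
  proof (rule christoffel_unique[where \<Gamma> = "\<lambda>k i j. (F y ** N y i) $ k $ j" and g = g and x = y, OF inv])
    show "g y $ i $ j = g y $ j $ i" for i j
      using sym by (metis transpose_def vec_lambda_beta)
    show "(F y ** N y i) $ k $ j = (F y ** N y j) $ k $ i" for k i j
      by (simp add: matrix_entry_mult N_sym[OF y, of i _ j])
    show "has_partial i (\<lambda>y. g y $ j $ l)
      (\<Sum>k\<in>UNIV. (F y ** N y i) $ k $ j * g y $ k $ l + (F y ** N y i) $ k $ l * g y $ j $ k) y" for i j l
      using has_partial_nth[OF has_partial_nth[OF deriv_metric[OF y, of i], of j], of l]
      by (simp add: matrix_entry_mult transpose_def sum.distrib mult.commute)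
  qed
qed

lemma deriv_\<omega>:
  assumes "y \<in> U"
  shows "has_partial i (\<lambda>y. \<omega> y j)
    (\<Sum>c\<in>UNIV. dE y i $ c $ j *\<^sub>R w y c + E y $ c $ j *\<^sub>R (\<Sum>d\<in>UNIV. E y $ d $ i *\<^sub>R dw y d c)) y"
  unfolding \<omega>_def
  by (intro has_partial_sum has_partial_scaleR has_partial_nth deriv_E deriv_w assms)

text \<open>Curvature is covariant under the gauge transformation: the terms with \<open>dE\<close>
  cancel on antisymmetrising, and those with \<open>ddE\<close> by symmetry of second derivatives.
  Passing to frame derivatives then differentiates \<open>E\<close> inside \<open>\<omega>\<close>;
  the torsion equation turns this into the bracket term.\<close>

theorem riemann_frame:
  assumes y: "y \<in> U"
  shows "riemann_uddd g y = act (F y) (transpose (E y)) (transpose (E y)) (transpose (E y)) (frame_curvature (w y) (dw y))"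
proof (intro ext)
  fix a b c d
  define d\<omega> where "d\<omega> i j = (\<Sum>c\<in>UNIV. dE y i $ c $ j *\<^sub>R w y c + E y $ c $ j *\<^sub>R (\<Sum>d\<in>UNIV. E y $ d $ i *\<^sub>R dw y d c))" for i j
  define dN where "dN i j = ddE y i j + (d\<omega> i j ** E y + \<omega> y j ** dE y i)" for i j
  define d\<Gamma> where "d\<Gamma> i j = - (F y ** dE y i ** F y) ** N y j + F y ** dN i j" for i j
  have der: "has_partial i (\<lambda>y. F y ** N y j) (d\<Gamma> i j) y" for i j
    unfolding d\<Gamma>_def dN_def N_def d\<omega>_def
    by (intro has_partial_matrix_mult has_partial_add deriv_F deriv_dE deriv_\<omega> deriv_E y)
  have "partial i (\<lambda>y. christoffel g y a j b) y = d\<Gamma> i j $ a $ b" for i j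
  proof (rule has_partial_imp_partial)
    have "has_partial i (\<lambda>y. (F y ** N y j) $ a $ b) (d\<Gamma> i j $ a $ b) y"
      by (intro has_partial_nth der)
    then show "has_partial i (\<lambda>y. christoffel g y a j b) (d\<Gamma> i j $ a $ b) y"
      by (subst has_partial_cong[OF open_U y christoffel_frame])
  qed
  then have "riemann_uddd g y a b c d =
      (d\<Gamma> c d - d\<Gamma> d c + (F y ** N y c) ** (F y ** N y d) - (F y ** N y d) ** (F y ** N y c)) $ a $ b"
    by (simp add: riemann_uddd_def christoffel_frame[OF y] matrix_entry_mult[of "F y ** N y c"] matrix_entry_mult[of "F y ** N y d"])
  also have "d\<Gamma> c d - d\<Gamma> d c + (F y ** N y c) ** (F y ** N y d) - (F y ** N y d) ** (F y ** N y c)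
     = F y ** (d\<omega> c d - d\<omega> d c + \<omega> y c ** \<omega> y d - \<omega> y d ** \<omega> y c) ** E y"
  proof -
    have c: "(X ** E y) ** F y = X" for X :: "real^'n^'n"
      by (metis EF[OF y] matrix_mul_assoc matrix_mul_rid)
    show ?thesis
      unfolding d\<Gamma>_def dN_def N_def matrix_algebra c
      by (simp add: ddE_sym[OF y, of d c])
  qed
  also have "d\<omega> c d - d\<omega> d c + \<omega> y c ** \<omega> y d - \<omega> y d ** \<omega> y c
     = (\<Sum>r\<in>UNIV. \<Sum>s\<in>UNIV. (E y $ r $ c * E y $ s $ d) *\<^sub>R (\<chi> p q. frame_curvature (w y) (dw y) p q r s))"
  proof -
    have 1: "d\<omega> i j = (\<Sum>f\<in>UNIV. dE y i $ f $ j *\<^sub>R w y f)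
        + (\<Sum>r\<in>UNIV. \<Sum>s\<in>UNIV. (E y $ r $ i * E y $ s $ j) *\<^sub>R dw y r s)" for i j
      unfolding d\<omega>_def
      by (simp add: sum.distrib scaleR_sum_right, subst sum.swap) (simp add: mult.commute)
    have 2: "d\<omega> j i = (\<Sum>f\<in>UNIV. dE y j $ f $ i *\<^sub>R w y f)
        + (\<Sum>r\<in>UNIV. \<Sum>s\<in>UNIV. (E y $ r $ i * E y $ s $ j) *\<^sub>R dw y s r)" for i j
      unfolding 1 by (subst (2) sum.swap) (simp add: mult.commute)
    have 3: "\<omega> y i ** \<omega> y j = (\<Sum>r\<in>UNIV. \<Sum>s\<in>UNIV. (E y $ r $ i * E y $ s $ j) *\<^sub>R (w y r ** w y s))" for i j
      unfolding \<omega>_def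
      by (simp add: mm.sum_left mm.sum_right mm.scaleR_left mm.scaleR_right scaleR_sum_right, subst sum.swap)
         (simp add: mult.commute)
    have 4: "\<omega> y j ** \<omega> y i = (\<Sum>r\<in>UNIV. \<Sum>s\<in>UNIV. (E y $ r $ i * E y $ s $ j) *\<^sub>R (w y s ** w y r))" for i j
      unfolding 3 by (subst sum.swap) (simp add: mult.commute)
    have 5: "(\<Sum>f\<in>UNIV. dE y i $ f $ j *\<^sub>R w y f) - (\<Sum>f\<in>UNIV. dE y j $ f $ i *\<^sub>R w y f)
      = (\<Sum>r\<in>UNIV. \<Sum>s\<in>UNIV. (E y $ r $ i * E y $ s $ j) *\<^sub>R (\<Sum>f\<in>UNIV. (w y s $ f $ r - w y r $ f $ s) *\<^sub>R w y f))" for i j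
    proof -
      have "(\<Sum>f\<in>UNIV. dE y i $ f $ j *\<^sub>R w y f) - (\<Sum>f\<in>UNIV. dE y j $ f $ i *\<^sub>R w y f)
        = (\<Sum>f\<in>UNIV. (dE y i $ f $ j - dE y j $ f $ i) *\<^sub>R w y f)"
        by (simp add: scaleR_diff_left sum_subtractf)
      also have "\<dots> = (\<Sum>f\<in>UNIV. \<Sum>r\<in>UNIV. \<Sum>s\<in>UNIV. (E y $ r $ i * E y $ s $ j) *\<^sub>R ((w y s $ f $ r - w y r $ f $ s) *\<^sub>R w y f))"
        by (simp add: torsion[OF y] scaleR_sum_left mult_ac)
      also have "\<dots> = (\<Sum>r\<in>UNIV. \<Sum>f\<in>UNIV. \<Sum>s\<in>UNIV. (E y $ r $ i * E y $ s $ j) *\<^sub>R ((w y s $ f $ r - w y r $ f $ s) *\<^sub>R w y f))"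
        by (rule sum.swap)
      also have "\<dots> = (\<Sum>r\<in>UNIV. \<Sum>s\<in>UNIV. \<Sum>f\<in>UNIV. (E y $ r $ i * E y $ s $ j) *\<^sub>R ((w y s $ f $ r - w y r $ f $ s) *\<^sub>R w y f))"
        by (rule sum.cong[OF refl sum.swap])
      finally show ?thesis by (simp add: scaleR_sum_right)
    qed
    have 6: "(\<chi> p q. frame_curvature (w y) (dw y) p q r s) = dw y r s - dw y s r + w y r ** w y s - w y s ** w y r
      + (\<Sum>f\<in>UNIV. (w y s $ f $ r - w y r $ f $ s) *\<^sub>R w y f)" for r s
      by (simp add: frame_curvature_def vec_eq_iff left_diff_distrib sum_subtractf)
    show ?thesis
      unfolding 6 scaleR_add_right scaleR_diff_right sum.distrib sum_subtractf 5[symmetric]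
      by (simp add: 1[of c d] 2[of d c] 3[of c d] 4[of d c])
  qed
  also have "(F y ** (\<Sum>r\<in>UNIV. \<Sum>s\<in>UNIV. (E y $ r $ c * E y $ s $ d) *\<^sub>R (\<chi> p q. frame_curvature (w y) (dw y) p q r s)) ** E y) $ a $ b
    = act (F y) (transpose (E y)) (transpose (E y)) (transpose (E y)) (frame_curvature (w y) (dw y)) a b c d"
  proof -
    have "F y ** (\<Sum>r\<in>UNIV. \<Sum>s\<in>UNIV. (E y $ r $ c * E y $ s $ d) *\<^sub>R (\<chi> p q. frame_curvature (w y) (dw y) p q r s)) ** E y
      = (\<Sum>r\<in>UNIV. \<Sum>s\<in>UNIV. (E y $ r $ c * E y $ s $ d) *\<^sub>R (F y ** (\<chi> p q. frame_curvature (w y) (dw y) p q r s) ** E y))"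
      by (simp add: mm.sum_left mm.sum_right mm.scaleR_left mm.scaleR_right scaleR_sum_right)
    also have "\<dots> $ a $ b = (\<Sum>r\<in>UNIV. \<Sum>s\<in>UNIV. \<Sum>q\<in>UNIV. \<Sum>p\<in>UNIV.
        F y $ a $ p * E y $ q $ b * E y $ r $ c * E y $ s $ d * frame_curvature (w y) (dw y) p q r s)"
      by (simp add: matrix_entry_mult sum_distrib_left sum_distrib_right mult_ac)
    also have "\<dots> = (\<Sum>q\<in>UNIV. \<Sum>p\<in>UNIV. \<Sum>r\<in>UNIV. \<Sum>s\<in>UNIV.
        F y $ a $ p * E y $ q $ b * E y $ r $ c * E y $ s $ d * frame_curvature (w y) (dw y) p q r s)"
      by (subst (1) sum_quad_inner(1), subst (1) sum_quad_inner(1)) (rule refl)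
    also have "\<dots> = (\<Sum>p\<in>UNIV. \<Sum>q\<in>UNIV. \<Sum>r\<in>UNIV. \<Sum>s\<in>UNIV.
        F y $ a $ p * E y $ q $ b * E y $ r $ c * E y $ s $ d * frame_curvature (w y) (dw y) p q r s)"
      by (rule sum.swap)
    finally show ?thesis by (simp add: act_expand transpose_def)
  qed
  finally show "riemann_uddd g y a b c d = \<dots>" .
qed

end

subsection \<open>Contractions in dimension four\<close>

definition pair_contract :: "'n::finite tensor4 \<Rightarrow> 'n tensor4 \<Rightarrow> 'n tensor4" where
  "pair_contract T U a b c d = (\<Sum>e\<in>UNIV. \<Sum>f\<in>UNIV. T a b e f * U e f c d)"

lemma pair_contract_free_slots:
  "pair_contract (act1 A T) U = act1 A (pair_contract T U)"
  "pair_contract (act2 A T) U = act2 A (pair_contract T U)"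
  "pair_contract T (act3 A U) = act3 A (pair_contract T U)"
  "pair_contract T (act4 A U) = act4 A (pair_contract T U)"
proof -
  have s: "(\<Sum>e\<in>UNIV. \<Sum>f\<in>UNIV. \<Sum>p\<in>UNIV. k e f p) = (\<Sum>p\<in>UNIV. \<Sum>e\<in>UNIV. \<Sum>f\<in>UNIV. k e f p)"
    for k :: "'a \<Rightarrow> 'a \<Rightarrow> 'a \<Rightarrow> real"
  proof -
    have "(\<Sum>e\<in>UNIV. \<Sum>f\<in>UNIV. \<Sum>p\<in>UNIV. k e f p) = (\<Sum>e\<in>UNIV. \<Sum>p\<in>UNIV. \<Sum>f\<in>UNIV. k e f p)"
      by (rule sum.cong[OF refl sum.swap])
    also have "\<dots> = (\<Sum>p\<in>UNIV. \<Sum>e\<in>UNIV. \<Sum>f\<in>UNIV. k e f p)"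
      by (rule sum.swap)
    finally show ?thesis .
  qed
  show "pair_contract (act1 A T) U = act1 A (pair_contract T U)"
    "pair_contract (act2 A T) U = act2 A (pair_contract T U)"
    "pair_contract T (act3 A U) = act3 A (pair_contract T U)"
    "pair_contract T (act4 A U) = act4 A (pair_contract T U)"
    unfolding fun_eq_iff pair_contract_def act_defs sum_distrib_left sum_distrib_right
    by (intro allI, subst s, simp add: mult_ac)+
qed

lemma pair_contract_adjoint:
  "pair_contract (act3 A T) U = pair_contract T (act1 (transpose A) U)"
  "pair_contract (act4 A T) U = pair_contract T (act2 (transpose A) U)"
  by (auto intro!: ext simp: pair_contract_def act_defs sum_adjoint)
     (subst sum.swap, subst (2) sum.swap, simp add: sum_adjoint)

text \<open>For the dual Weyl tensor the products at the contracted slots become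
  \<open>diag_mat k\<close>, so the coframe survives only in the free slots.\<close>

lemma pair_contract_act:
  "pair_contract (act A B C D T) (act A' B' C' D' U) =
    act A B C' D' (pair_contract T (act (transpose C ** A') (transpose D ** B') (mat 1) (mat 1) U))"
proof -
  have "act A' B' C' D' U = act3 C' (act4 D' (act1 A' (act2 B' U)))"
    by (simp add: act_def act_slot_commute)
  moreover have "act A B C D T = act1 A (act2 B (act3 C (act4 D T)))"
    by (simp add: act_def)
  ultimately show ?thesis
    by (simp only: pair_contract_free_slots pair_contract_adjoint)
       (simp add: act_def act_slot_commute act_slot_mult)
qed

section \<open>The permutation symbol and determinants\<close>

lemma vector_4 [simp]:
  "(vector [x, y, z, u] :: 'a::zero^4) $ 1 = x"
  "(vector [x, y, z, u] :: 'a::zero^4) $ 2 = y"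
  "(vector [x, y, z, u] :: 'a::zero^4) $ 3 = z"
  "(vector [x, y, z, u] :: 'a::zero^4) $ 4 = u"
  unfolding vector_def by simp_all

lemma det_4:
  "det (A::'a::comm_ring_1^4^4) =
    A$1$1 * (A$2$2 * A$3$3 * A$4$4 + A$2$3 * A$3$4 * A$4$2 + A$2$4 * A$3$2 * A$4$3
      - A$2$2 * A$3$4 * A$4$3 - A$2$3 * A$3$2 * A$4$4 - A$2$4 * A$3$3 * A$4$2)
    - A$1$2 * (A$2$1 * A$3$3 * A$4$4 + A$2$3 * A$3$4 * A$4$1 + A$2$4 * A$3$1 * A$4$3
      - A$2$1 * A$3$4 * A$4$3 - A$2$3 * A$3$1 * A$4$4 - A$2$4 * A$3$3 * A$4$1)
    + A$1$3 * (A$2$1 * A$3$2 * A$4$4 + A$2$2 * A$3$4 * A$4$1 + A$2$4 * A$3$1 * A$4$2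
      - A$2$1 * A$3$4 * A$4$2 - A$2$2 * A$3$1 * A$4$4 - A$2$4 * A$3$2 * A$4$1)
    - A$1$4 * (A$2$1 * A$3$2 * A$4$3 + A$2$2 * A$3$3 * A$4$1 + A$2$3 * A$3$1 * A$4$2
      - A$2$1 * A$3$3 * A$4$2 - A$2$2 * A$3$1 * A$4$3 - A$2$3 * A$3$2 * A$4$1)"
proof -
  have f1: "finite {2::4, 3, 4}" "1 \<notin> {2::4, 3, 4}" by auto
  have f2: "finite {3::4, 4}" "2 \<notin> {3::4, 4}" by auto
  have f3: "finite {4::4}" "3 \<notin> {4::4}" by auto
  show ?thesis
    unfolding det_def UNIV_4
    unfolding sum_over_permutations_insert[OF f1]
    unfolding sum_over_permutations_insert[OF f2]
    unfolding sum_over_permutations_insert[OF f3]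
    unfolding permutes_sing
    by (simp add: sign_swap_id permutation_swap_id permutation_compose sign_compose sign_id swap_id_eq algebra_simps)
qed

lemma permutation_symbol_repeat [simp]:
  "permutation_symbol a a c d = 0" "permutation_symbol a b a d = 0" "permutation_symbol a b c a = 0"
  "permutation_symbol a b b d = 0" "permutation_symbol a b c b = 0" "permutation_symbol a b c c = 0"
  by (simp_all add: permutation_symbol_def det_4 algebra_simps)

lemma permutation_symbol_values [simp]:
  "permutation_symbol 1 2 3 4 = 1" "permutation_symbol 1 2 4 3 = -1" "permutation_symbol 1 3 2 4 = -1"
  "permutation_symbol 1 3 4 2 = 1" "permutation_symbol 1 4 2 3 = 1" "permutation_symbol 1 4 3 2 = -1"
  "permutation_symbol 2 1 3 4 = -1" "permutation_symbol 2 1 4 3 = 1" "permutation_symbol 2 3 1 4 = 1"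
  "permutation_symbol 2 3 4 1 = -1" "permutation_symbol 2 4 1 3 = -1" "permutation_symbol 2 4 3 1 = 1"
  "permutation_symbol 3 1 2 4 = 1" "permutation_symbol 3 1 4 2 = -1" "permutation_symbol 3 2 1 4 = -1"
  "permutation_symbol 3 2 4 1 = 1" "permutation_symbol 3 4 1 2 = 1" "permutation_symbol 3 4 2 1 = -1"
  "permutation_symbol 4 1 2 3 = -1" "permutation_symbol 4 1 3 2 = 1" "permutation_symbol 4 2 1 3 = 1"
  "permutation_symbol 4 2 3 1 = -1" "permutation_symbol 4 3 1 2 = -1" "permutation_symbol 4 3 2 1 = 1"
  by (simp_all add: permutation_symbol_def det_4 axis_def)

lemma det_vector_4_rows:
  fixes u v w z :: "real^4"
  shows "(\<Sum>p\<in>UNIV. u $ p * det (vector [axis p 1, v, w, z] :: real^4^4)) = det (vector [u, v, w, z] :: real^4^4)"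
    and "(\<Sum>p\<in>UNIV. v $ p * det (vector [u, axis p 1, w, z] :: real^4^4)) = det (vector [u, v, w, z] :: real^4^4)"
    and "(\<Sum>p\<in>UNIV. w $ p * det (vector [u, v, axis p 1, z] :: real^4^4)) = det (vector [u, v, w, z] :: real^4^4)"
    and "(\<Sum>p\<in>UNIV. z $ p * det (vector [u, v, w, axis p 1] :: real^4^4)) = det (vector [u, v, w, z] :: real^4^4)"
  by (simp_all add: sum_4 det_4 axis_def algebra_simps)

text \<open>Multilinearity of the determinant in its rows. The factor \<open>det M\<close> is what
  the square root in \<open>levi_civita\<close> matches, up to sign.\<close>

lemma act_permutation_symbol:
  "act M M M M permutation_symbol a b c d = det M * permutation_symbol a b c d"
proof -
  have "act M M M M permutation_symbol a b c d = det (vector [M $ a, M $ b, M $ c, M $ d] :: real^4^4)"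
    by (simp add: act_def act_defs permutation_symbol_def det_vector_4_rows)
  also have "vector [M $ a, M $ b, M $ c, M $ d] = (vector [axis a 1, axis b 1, axis c 1, axis d 1] :: real^4^4) ** M"
    by (simp add: vec_eq_iff forall_4 matrix_entry_mult axis_def if_distrib[of "\<lambda>z. z * _"] cong: if_cong)
  finally show ?thesis
    by (simp add: det_mul permutation_symbol_def[of a b c d])
qed

section \<open>Constant curvature and type D tensors in a diagonal frame\<close>

definition diag_mat :: "real^'n \<Rightarrow> real^'n^'n" where
  "diag_mat h = (\<chi> i j. if i = j then h $ i else 0)"

lemma diag_mat_nth: "diag_mat h $ i $ j = (if i = j then h $ i else 0)"
  by (simp add: diag_mat_def)

lemma transpose_diag_mat [simp]: "transpose (diag_mat h) = diag_mat h"
  by (simp add: diag_mat_def transpose_def vec_eq_iff)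

lemma act_slot_diag_mat:
  "act1 (diag_mat k) T = (\<lambda>a b c d. k $ a * T a b c d)"
  "act2 (diag_mat k) T = (\<lambda>a b c d. k $ b * T a b c d)"
  "act3 (diag_mat k) T = (\<lambda>a b c d. k $ c * T a b c d)"
  "act4 (diag_mat k) T = (\<lambda>a b c d. k $ d * T a b c d)"
  by (simp_all add: fun_eq_iff act_defs diag_mat_nth if_distrib[of "\<lambda>z. z * _"] cong: if_cong)

lemma det_diag_mat_4: "det (diag_mat h :: real^4^4) = h $ 1 * h $ 2 * h $ 3 * h $ 4"
  by (simp add: det_4 diag_mat_nth)

text \<open>The curvature tensor of a space form of curvature one, half the Kulkarni-Nomizu square
  of the metric.\<close>

definition area_form :: "real^'n^'n \<Rightarrow> 'n tensor4" where
  "area_form g a b c d = g $ a $ c * g $ b $ d - g $ a $ d * g $ b $ c"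

lemma act_product:
  "act A B (transpose C) (transpose D) (\<lambda>a b c d. M $ a $ c * N $ b $ d) a b c d = (A ** M ** C) $ a $ c * (B ** N ** D) $ b $ d"
  "act A B (transpose C) (transpose D) (\<lambda>a b c d. M $ a $ d * N $ b $ c) a b c d = (A ** M ** D) $ a $ d * (B ** N ** C) $ b $ c"
proof -
  have s: "(\<lambda>a b c d. M $ a $ d * N $ b $ c) = (\<lambda>a b c d. N $ b $ c * M $ a $ d)" for M N :: "real^'a^'a"
    by (simp add: mult.commute)
  have 1: "act4 (transpose D) (\<lambda>a b c d. M $ a $ c * N $ b $ d) = (\<lambda>a b c d. M $ a $ c * (N ** D) $ b $ d)"
    "act3 (transpose D) (\<lambda>a b c d. M $ a $ c * N $ b $ d) = (\<lambda>a b c d. (M ** D) $ a $ c * N $ b $ d)"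
    "act2 D (\<lambda>a b c d. M $ a $ c * N $ b $ d) = (\<lambda>a b c d. M $ a $ c * (D ** N) $ b $ d)"
    "act1 D (\<lambda>a b c d. M $ a $ c * N $ b $ d) = (\<lambda>a b c d. (D ** M) $ a $ c * N $ b $ d)"
    "act4 (transpose D) (\<lambda>a b c d. M $ a $ d * N $ b $ c) = (\<lambda>a b c d. (M ** D) $ a $ d * N $ b $ c)"
    "act3 (transpose D) (\<lambda>a b c d. M $ a $ d * N $ b $ c) = (\<lambda>a b c d. M $ a $ d * (N ** D) $ b $ c)"
    "act2 D (\<lambda>a b c d. M $ a $ d * N $ b $ c) = (\<lambda>a b c d. M $ a $ d * (D ** N) $ b $ c)"
    "act1 D (\<lambda>a b c d. M $ a $ d * N $ b $ c) = (\<lambda>a b c d. (D ** M) $ a $ d * N $ b $ c)"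
    for D M N :: "real^'a^'a"
    by (simp_all add: fun_eq_iff act_defs matrix_entry_mult transpose_def sum_distrib_left sum_distrib_right mult_ac)
  show "act A B (transpose C) (transpose D) (\<lambda>a b c d. M $ a $ c * N $ b $ d) a b c d = (A ** M ** C) $ a $ c * (B ** N ** D) $ b $ d"
    "act A B (transpose C) (transpose D) (\<lambda>a b c d. M $ a $ d * N $ b $ c) a b c d = (A ** M ** D) $ a $ d * (B ** N ** C) $ b $ c"
    by (simp_all add: act_def 1 matrix_mul_assoc)
qed

lemma act_area_form:
  "act (transpose E) (transpose E) (transpose E) (transpose E) (area_form H) a b c d = area_form (transpose E ** H ** E) a b c d"
proof -
  have "area_form H = (\<lambda>a b c d. H $ a $ c * H $ b $ d - H $ a $ d * H $ b $ c)"
    by (simp add: area_form_def fun_eq_iff)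
  then show ?thesis
    by (simp add: act_diff act_product area_form_def)
qed

text \<open>The scalar curvature is \<open>12 * l\<close>, so the Ricci part contributes
  \<open>- 3 * l\<close> and the scalar part \<open>2 * l\<close> times the area form.\<close>

lemma weyl_einstein:
  fixes g :: "4 metric"
  assumes inv: "inv_metric g x ** g x = mat 1" and sym: "transpose (g x) = g x"
    and ric: "\<And>b d. ricci g x b d = 3 * l * g x $ b $ d"
  shows "weyl g x a b c d = riemann g x a b c d - l * area_form (g x) a b c d"
proof -
  have "scalar_curvature g x = 3 * l * (\<Sum>b\<in>UNIV. (inv_metric g x ** transpose (g x)) $ b $ b)"
    by (simp add: scalar_curvature_def ric matrix_entry_mult transpose_def sum_distrib_left mult_ac)
  then have "scalar_curvature g x = 12 * l"
    by (simp add: sym inv mat_def)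
  then show ?thesis
    by (simp add: weyl_def ric area_form_def algebra_simps)
qed

text \<open>
  \<open>X\<close> and \<open>Y\<close> are the real and imaginary parts of the Weyl scalar \<open>\<Psi>\<^sub>2\<close> (up to sign) in a frame
  adapted to both principal null directions: on bivectors the Weyl tensor is \<open>(X + Y \<star>) \<kappa>\<close>, where
  \<open>\<kappa>\<close> is \<open>2\<close> on the planes \<open>12\<close> and \<open>34\<close> and \<open>-1\<close> on the others.
\<close>

definition type_D :: "real^4 \<Rightarrow> real \<Rightarrow> real \<Rightarrow> 4 tensor4" where
  "type_D h X Y p q r s = (if (p \<in> {1, 2}) = (q \<in> {1, 2}) then 2 else -1) *
     (X * area_form (diag_mat h) p q r s + Y * permutation_symbol p q r s)"

lemma unimodular_pairs:
  fixes h :: "real^4"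
  assumes h: "h $ 1 * h $ 2 = -1" "h $ 3 * h $ 4 = 1"
  shows "h $ 2 = - (1 / h $ 1)" "h $ 4 = 1 / h $ 3" "h $ 1 \<noteq> 0" "h $ 3 \<noteq> 0"
proof -
  show nz: "h $ 1 \<noteq> 0" "h $ 3 \<noteq> 0" using h by auto
  show "h $ 2 = - (1 / h $ 1)" using h(1) nz
    by (metis divide_minus_left nonzero_mult_div_cancel_left)
  show "h $ 4 = 1 / h $ 3" using h(2) nz by (metis nonzero_mult_div_cancel_left)
qed

text \<open>For each \<open>q\<close> the weights 2, -1, -1 of the planes through \<open>q\<close>
  add up to zero, the permutation symbol has no trace by skewness, and a space form has Ricci tensor
  three times its curvature.\<close>

lemma type_D_trace:
  assumes "h $ 1 * h $ 2 = -1" "h $ 3 * h $ 4 = 1"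
  shows "(\<Sum>p\<in>UNIV. (type_D h X Y p q p s + l * area_form (diag_mat h) p q p s) / h $ p) = 3 * l * diag_mat h $ q $ s"
proof -
  have nz: "h $ p \<noteq> 0" for p using assms exhaust_4[of p] by auto
  have "\<forall>q s. (\<Sum>p\<in>UNIV. (type_D h X Y p q p s + l * area_form (diag_mat h) p q p s) / h $ p) = 3 * l * diag_mat h $ q $ s"
    unfolding forall_4 sum_4
    by (simp add: type_D_def area_form_def diag_mat_nth nz add_divide_distrib diff_divide_distrib)
  then show ?thesis by blast
qed

text \<open>The weights give 48 = 2 * (4 * 4 + 8 * 1), summed over ordered pairs. Mixed terms
  vanish, since the area form needs equal planes and the symbol complementary ones; the minus sign
  is the product of the four entries of \<open>h\<close>.\<close>

lemma type_D_norm: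
  assumes h: "h $ 1 * h $ 2 = -1" "h $ 3 * h $ 4 = 1" and k: "k = (\<chi> i. 1 / h $ i)"
  shows "contract (type_D h X Y) (act (diag_mat k) (diag_mat k) (diag_mat k) (diag_mat k) (type_D h X' Y')) = 48 * (X * X' - Y * Y')"
proof -
  have h2: "h $ 2 = - (1 / h $ 1)" and h4: "h $ 4 = 1 / h $ 3" and nz: "h $ 1 \<noteq> 0" "h $ 3 \<noteq> 0"
    using unimodular_pairs[OF h] .
  show ?thesis
    unfolding contract_def act_def act_slot_diag_mat sum_4
    by (simp add: type_D_def area_form_def diag_mat_nth h2 h4 nz k)
qed

text \<open>The weights agree on complementary planes, so they commute with the Hodge star, which
  squares to -1: dualising multiplies X + iY by i. The factor 2 counts ordered pairs and cancels the
  1/2 of \<open>dual_weyl\<close>.\<close>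

lemma type_D_dual:
  assumes h: "h $ 1 * h $ 2 = -1" "h $ 3 * h $ 4 = 1" and k: "k = (\<chi> i. 1 / h $ i)"
  shows "pair_contract permutation_symbol (act (diag_mat k) (diag_mat k) (mat 1) (mat 1) (type_D h X Y)) p q r s
    = 2 * type_D h (- Y) X p q r s"
proof -
  have h2: "h $ 2 = - (1 / h $ 1)" and h4: "h $ 4 = 1 / h $ 3" and nz: "h $ 1 \<noteq> 0" "h $ 3 \<noteq> 0"
    using unimodular_pairs[OF h] .
  have "\<forall>p q r s. pair_contract permutation_symbol (act (diag_mat k) (diag_mat k) (mat 1) (mat 1) (type_D h X Y)) p q r s
    = 2 * type_D h (- Y) X p q r s"
    unfolding pair_contract_def act_def act_slot_diag_mat act_slot_id sum_4 forall_4
    by (simp add: type_D_def area_form_def diag_mat_nth h2 h4 nz k)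
  then show ?thesis by blast
qed

text \<open>With Z = X + iY the norm is 48 Re(Z^2); dualising one factor gives 48 Re(iZ * Z) = -96
  XY.\<close>

lemma type_D_invariants:
  fixes g :: "4 metric"
  assumes FE: "F ** E = mat 1" and metric: "g x = transpose E ** diag_mat h ** E"
    and h: "h $ 1 * h $ 2 = -1" "h $ 3 * h $ 4 = 1"
    and riem: "riemann_uddd g x = act F (transpose E) (transpose E) (transpose E) K"
    and K: "\<And>p q r s. h $ p * K p q r s = type_D h X Y p q r s + l * area_form (diag_mat h) p q r s"
  shows "inv_metric g x = F ** diag_mat (\<chi> i. 1 / h $ i) ** transpose F"
    and "I1 g x = 48 * (X\<^sup>2 - Y\<^sup>2)"
    and "I2 g x = - 96 * sgn (det E) * (X * Y)"
proof -
  define k where "k = (\<chi> i. 1 / h $ i)"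
  \<comment> \<open>\<open>M\<close> is the frame with its index raised:
    \<open>M ** transpose F\<close> is the inverse metric, and raising an index turns
    \<open>transpose E\<close> into \<open>M\<close>.\<close>
  define M where "M = F ** diag_mat k"
  have nz: "h $ p \<noteq> 0" for p using h exhaust_4[of p] by auto
  have EF: "E ** F = mat 1" using FE matrix_left_right_inverse by blast
  have kh: "diag_mat k ** diag_mat h = mat 1"
    by (simp add: vec_eq_iff matrix_entry_mult diag_mat_nth mat_def k_def nz if_distrib[of "\<lambda>z. z * _"] cong: if_cong)
  have FtEt: "transpose F ** transpose E = mat 1"
    by (metis EF matrix_transpose_mul transpose_mat)
  have MEt: "M ** transpose F ** transpose E = M"
    by (metis FtEt matrix_mul_assoc matrix_mul_rid)
  have inv: "(M ** transpose F) ** g x = mat 1"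
    by (metis (no_types, lifting) FE M_def MEt kh matrix_mul_assoc matrix_mul_rid metric)
  then have G: "inv_metric g x = M ** transpose F"
    by (simp add: inv_metric_def matrix_inv_eqI)
  then show "inv_metric g x = F ** diag_mat (\<chi> i. 1 / h $ i) ** transpose F"
    by (simp add: M_def k_def)
  have sym: "transpose (g x) = g x"
    by (simp add: metric matrix_transpose_mul matrix_mul_assoc)

  have ric: "ricci g x b d = 3 * l * g x $ b $ d" for b d
  proof -
    have "K p q p s = (type_D h X Y p q p s + l * area_form (diag_mat h) p q p s) / h $ p" for p q s
      using K[of p q p s] nz[of p] by (simp add: field_simps)
    then have "ricci g x b d = (\<Sum>q\<in>UNIV. \<Sum>s\<in>UNIV. transpose E $ b $ q * transpose E $ d $ s * (3 * l * diag_mat h $ q $ s))"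
      by (simp only: ricci_def riem trace_act[OF EF] type_D_trace[OF h])
    also have "\<dots> = 3 * l * (\<Sum>s\<in>UNIV. \<Sum>q\<in>UNIV. transpose E $ b $ q * diag_mat h $ q $ s * E $ s $ d)"
      by (subst sum.swap) (simp add: sum_distrib_left mult_ac transpose_def)
    finally show ?thesis
      by (simp add: metric matrix_entry_mult sum_distrib_right)
  qed
  have W: "weyl g x = act (transpose E) (transpose E) (transpose E) (transpose E) (type_D h X Y)"
  proof (intro ext)
    fix a b c d
    have gF: "g x ** F = transpose E ** diag_mat h"
      by (metis EF matrix_mul_assoc matrix_mul_rid metric)
    have "riemann g x = act (g x) (mat 1) (mat 1) (mat 1) (riemann_uddd g x)"
      by (simp add: fun_eq_iff riemann_def act_def) (simp add: act_defs)
    also have "\<dots> = act (transpose E) (transpose E) (transpose E) (transpose E) (act (diag_mat h) (mat 1) (mat 1) (mat 1) K)"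
      by (simp add: riem act_act gF)
    also have "act (diag_mat h) (mat 1) (mat 1) (mat 1) K
        = (\<lambda>p q r s. type_D h X Y p q r s + l * area_form (diag_mat h) p q r s)"
      by (simp add: act_def act_slot_diag_mat K)
    finally show "weyl g x a b c d = act (transpose E) (transpose E) (transpose E) (transpose E) (type_D h X Y) a b c d"
      unfolding weyl_einstein[OF inv[folded G] sym ric]
      by (simp only: act_add act_scale act_area_form metric add_diff_cancel_right')
  qed
  have Wuudd: "weyl_uudd g x = act M M (transpose E) (transpose E) (type_D h X Y)"
  proof -
    have "weyl_uudd g x = act (M ** transpose F) (M ** transpose F) (mat 1) (mat 1) (weyl g x)"
      by (simp add: fun_eq_iff weyl_uudd_def act_def G) (simp add: act_defs sum_distrib_left mult.assoc)
    then show ?thesis by (simp add: W act_act MEt)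
  qed
  have Wuuuu: "weyl_uuuu g x = act F F F F (act (diag_mat k) (diag_mat k) (diag_mat k) (diag_mat k) (type_D h X Y))"
  proof -
    have "weyl_uuuu g x = act (mat 1) (mat 1) (M ** transpose F) (M ** transpose F) (weyl_uudd g x)"
      by (simp add: fun_eq_iff weyl_uuuu_def act_def G) (simp add: act_defs sum_distrib_left mult.assoc)
    then show ?thesis by (simp add: Wuudd act_act MEt) (simp add: M_def)
  qed
  show "I1 g x = 48 * (X\<^sup>2 - Y\<^sup>2)"
    unfolding I1_def contract_def[symmetric] W Wuuuu contract_act_dual[OF EF] type_D_norm[OF h k_def]
    by (simp add: power2_eq_square)

  have LC: "levi_civita g x a b c d
      = sgn (det E) * act (transpose E) (transpose E) (transpose E) (transpose E) permutation_symbol a b c d" for a b c d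
  proof -
    \<comment> \<open>The root yields only |det E|, which is where the orientation sign of the
      coframe enters.\<close>
    have "det (g x) = - (det E)\<^sup>2"
      using h by (simp add: metric det_mul det_transpose det_diag_mat_4 power2_eq_square mult.assoc)
    then have "sqrt \<bar>det (g x)\<bar> = sgn (det E) * det E"
      by (simp add: mult.commute[of "sgn _"] abs_sgn[symmetric])
    then show ?thesis
      by (simp add: levi_civita_def act_permutation_symbol det_transpose)
  qed
  have dual: "dual_weyl g x = (\<lambda>a b c d. sgn (det E) *
      act (transpose E) (transpose E) (transpose E) (transpose E) (type_D h (- Y) X) a b c d)"
  proof (intro ext)
    fix a b c d
    have EM: "E ** M = diag_mat k" by (simp add: M_def matrix_mul_assoc EF)
    have "dual_weyl g x a b c d = 1 / 2 * sgn (det E) * pair_contract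
       (act (transpose E) (transpose E) (transpose E) (transpose E) permutation_symbol)
       (act M M (transpose E) (transpose E) (type_D h X Y)) a b c d"
      by (simp add: dual_weyl_def LC Wuudd pair_contract_def sum_distrib_left mult.assoc)
    also have "pair_contract
       (act (transpose E) (transpose E) (transpose E) (transpose E) permutation_symbol)
       (act M M (transpose E) (transpose E) (type_D h X Y))
       = act (transpose E) (transpose E) (transpose E) (transpose E) (\<lambda>p q r s. 2 * type_D h (- Y) X p q r s)"
      by (simp add: pair_contract_act EM type_D_dual[OF h k_def, abs_def])
    finally show "dual_weyl g x a b c d = sgn (det E) *
      act (transpose E) (transpose E) (transpose E) (transpose E) (type_D h (- Y) X) a b c d"
      by (simp add: act_scale)
  qed
  have "I2 g x = sgn (det E) * contract
      (act (transpose E) (transpose E) (transpose E) (transpose E) (type_D h (- Y) X)) (weyl_uuuu g x)"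
    by (simp add: I2_def dual contract_def sum_distrib_left mult.assoc)
  then show "I2 g x = - 96 * sgn (det E) * (X * Y)"
    by (simp add: Wuuuu contract_act_dual[OF EF] type_D_norm[OF h k_def] algebra_simps)
qed

subsection \<open>Derivatives of functions of \<open>r\<close> and \<open>cos \<theta>\<close>\<close>

lemma has_partial_real:
  "has_partial i f f' x \<longleftrightarrow> ((\<lambda>h. f (x + h *\<^sub>R axis i 1)) has_real_derivative f') (at 0)"
  by (simp add: has_partial_def has_real_derivative_iff_has_vector_derivative)

lemma has_partial_matrix:
  fixes f :: "real^'n::finite \<Rightarrow> real^'m^'k"
  assumes "\<And>a b. ((\<lambda>h. f (x + h *\<^sub>R axis i 1) $ a $ b) has_real_derivative f' $ a $ b) (at 0)"
  shows "has_partial i f f' x"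
  by (intro has_partial_vec) (simp add: has_partial_real assms)

text \<open>\<open>fr\<close> and \<open>fc\<close> are derivatives in r and c = cos theta; the
  chain rule supplies - sin theta. Since dr and d(cos theta) belong to the coframe, they are also
  the derivatives along the second and third frame vectors.\<close>

definition has_rc_partials :: "(real^4 \<Rightarrow> real) \<Rightarrow> real \<Rightarrow> real \<Rightarrow> real^4 \<Rightarrow> bool" where
  "has_rc_partials f fr fc y \<longleftrightarrow>
    (\<forall>i. has_partial i f (if i = 2 then fr else if i = 3 then - sin (y $ 3) * fc else 0) y)"

text \<open>Lets the rules build the derivatives as unknowns and leaves the comparison with the
  wanted form to algebra.\<close>

lemma has_rc_partials_eqI:
  "has_rc_partials f fr fc y \<Longrightarrow> fr = fr' \<Longrightarrow> fc = fc' \<Longrightarrow> has_rc_partials f fr' fc' y"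
  by simp

lemma has_rc_partials_r: "has_rc_partials (\<lambda>y. y $ 2) 1 0 y"
  unfolding has_rc_partials_def has_partial_real by (auto intro!: derivative_eq_intros simp: axis_def)

lemma has_rc_partials_cos: "has_rc_partials (\<lambda>y. cos (y $ 3)) 0 1 y"
  unfolding has_rc_partials_def has_partial_real by (auto intro!: derivative_eq_intros simp: axis_def)

lemma has_rc_partials_const: "has_rc_partials (\<lambda>_. k) 0 0 y"
  unfolding has_rc_partials_def by simp

lemma has_rc_partials_add:
  assumes "has_rc_partials f fr fc y" "has_rc_partials g gr gc y"
  shows "has_rc_partials (\<lambda>y. f y + g y) (fr + gr) (fc + gc) y"
  unfolding has_rc_partials_def
proof
  fix i
  show "has_partial i (\<lambda>y. f y + g y) (if i = 2 then fr + gr else if i = 3 then - sin (y $ 3) * (fc + gc) else 0) y"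
    using has_partial_add[OF assms[unfolded has_rc_partials_def, rule_format, of i]]
    by (cases "i = 2"; cases "i = 3"; simp add: algebra_simps)
qed

lemma has_rc_partials_mult:
  assumes "has_rc_partials f fr fc y" "has_rc_partials g gr gc y"
  shows "has_rc_partials (\<lambda>y. f y * g y) (fr * g y + f y * gr) (fc * g y + f y * gc) y"
  unfolding has_rc_partials_def
proof
  fix i
  show "has_partial i (\<lambda>y. f y * g y)
      (if i = 2 then fr * g y + f y * gr else if i = 3 then - sin (y $ 3) * (fc * g y + f y * gc) else 0) y"
    using has_partial_mult[OF assms[unfolded has_rc_partials_def, rule_format, of i]]
    by (cases "i = 2"; cases "i = 3"; simp add: algebra_simps)
qed

lemma has_rc_partials_minus:
  "has_rc_partials f fr fc y \<Longrightarrow> has_rc_partials (\<lambda>y. - f y) (- fr) (- fc) y"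
  using has_rc_partials_mult[OF has_rc_partials_const[of "-1" y], of f fr fc] by simp

lemma has_rc_partials_diff:
  "has_rc_partials f fr fc y \<Longrightarrow> has_rc_partials g gr gc y \<Longrightarrow> has_rc_partials (\<lambda>y. f y - g y) (fr - gr) (fc - gc) y"
  using has_rc_partials_add[OF _ has_rc_partials_minus, of f fr fc y g gr gc] by simp

lemma has_rc_partials_inverse:
  assumes "has_rc_partials g gr gc y" "g y \<noteq> 0"
  shows "has_rc_partials (\<lambda>y. inverse (g y)) (- (gr * inverse (g y) * inverse (g y))) (- (gc * inverse (g y) * inverse (g y))) y"
  unfolding has_rc_partials_def
proof
  fix i
  show "has_partial i (\<lambda>y. inverse (g y)) (if i = 2 then - (gr * inverse (g y) * inverse (g y)) else if i = 3 then
      - sin (y $ 3) * - (gc * inverse (g y) * inverse (g y)) else 0) y"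
    using DERIV_inverse'[OF assms(1)[unfolded has_rc_partials_def has_partial_real, rule_format, of i]] assms(2)
    unfolding has_partial_real
    by (cases "i = 2"; cases "i = 3"; simp add: algebra_simps)
qed

lemma has_rc_partials_divide:
  assumes "has_rc_partials f fr fc y" "has_rc_partials g gr gc y" "g y \<noteq> 0"
  shows "has_rc_partials (\<lambda>y. f y / g y) (fr / g y - f y * gr / (g y * g y)) (fc / g y - f y * gc / (g y * g y)) y"
  unfolding divide_inverse
  by (rule has_rc_partials_eqI[OF has_rc_partials_mult[OF assms(1) has_rc_partials_inverse[OF assms(2,3)]]])
     (simp_all add: mult_ac)

lemma has_rc_partials_power2:
  "has_rc_partials f fr fc y \<Longrightarrow> has_rc_partials (\<lambda>y. (f y)\<^sup>2) (2 * f y * fr) (2 * f y * fc) y"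
  unfolding power2_eq_square
  by (rule has_rc_partials_eqI[OF has_rc_partials_mult]) (assumption | algebra)+

lemmas has_rc_partials_intros = has_rc_partials_r has_rc_partials_cos has_rc_partials_const has_rc_partials_add
  has_rc_partials_minus has_rc_partials_diff has_rc_partials_mult has_rc_partials_divide has_rc_partials_power2

lemma has_rc_partials_cong:
  assumes "open V" "y \<in> V" "\<And>z. z \<in> V \<Longrightarrow> f z = g z"
  shows "has_rc_partials f fr fc y \<longleftrightarrow> has_rc_partials g fr fc y"
  unfolding has_rc_partials_def by (simp only: has_partial_cong[OF assms])

subsection \<open>The connection and the curvature in the Carter frame\<close>

text \<open>
  The frame is \<open>\<alpha>/\<Xi>, dr, d(cos \<theta>), \<beta>/\<Xi>\<close>, with squared lengths \<open>-D/\<rho>\<^sup>2, \<rho>\<^sup>2/D, \<rho>\<^sup>2/P, P/\<rho>\<^sup>2\<close>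
  where \<open>D = \<Delta>\<^sub>r\<close> and \<open>P = \<Delta>\<^sub>\<theta> sin\<^sup>2 \<theta>\<close>.  With \<open>u + i v = 1/(r - i a cos \<theta>)\<close> and \<open>q = u\<^sup>2 + v\<^sup>2 = 1/\<rho>\<^sup>2\<close>
  the connection coefficients are rational in \<open>u, v, q, D, P, D', P'\<close>.  The first index of the table is the
  direction of differentiation.
\<close>

definition carter_lengths :: "real \<Rightarrow> real \<Rightarrow> real \<Rightarrow> real^4" where
  "carter_lengths q D P = vector [- (D * q), 1 / (q * D), 1 / (q * P), P * q]"

definition carter_conn :: "real \<Rightarrow> real \<Rightarrow> real \<Rightarrow> real \<Rightarrow> real \<Rightarrow> real \<Rightarrow> real \<Rightarrow> real \<Rightarrow> real^4^4^4" where
  "carter_conn a u v q D P D1 P1 = vector [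
    vector [
      vector [0, D1/(2 * D) - u, a * v, 0],
      vector [D * D1 * q * q/2 - D * D * q * q * u, 0, 0, D * P * a * q * q * u],
      vector [D * P * a * q * q * v, 0, 0, - D * P * q * q * v],
      vector [0, - a * u, D * v/P, 0]],
    vector [
      vector [D1/(2 * D) - u, 0, 0, P * a * u/D],
      vector [0, - D1/(2 * D) + u, a * v, 0],
      vector [0, - P * a * v/D, u, 0],
      vector [a * u, 0, 0, - u]],
    vector [
      vector [- a * v, 0, 0, v],
      vector [0, a * v, - D * u/P, 0],
      vector [0, u, - P1/(2 * P) + a * v, 0],
      vector [D * v/P, 0, 0, P1/(2 * P) - a * v]],
    vector [
      vector [0, P * a * u/D, - v, 0],
      vector [D * P * a * q * q * u, 0, 0, - D * P * q * q * u],
      vector [- D * P * q * q * v, 0, 0, - P * P1 * q * q/2 + P * P * a * q * q * v],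
      vector [0, u, P1/(2 * P) - a * v, 0]]]"

text \<open>Entrywise r-derivative of \<open>carter_conn\<close>, by u_r = v^2 - u^2, v_r = -2uv,
  q_r = -2uq; verified in \<open>conn_partials\<close>.\<close>

definition carter_conn_dr :: "real \<Rightarrow> real \<Rightarrow> real \<Rightarrow> real \<Rightarrow> real \<Rightarrow> real \<Rightarrow> real \<Rightarrow> real \<Rightarrow> real \<Rightarrow> real^4^4^4" where
  "carter_conn_dr a u v q D P D1 P1 D2 = vector [
    vector [
      vector [0, - D1 * D1/(2 * D * D) + D2/(2 * D) + u * u - v * v, - 2 * a * u * v, 0],
      vector [- 4 * D * D1 * q * q * u + D * D2 * q * q/2 + 5 * D * D * q * q * u * u - D * D * q * q * v * v + D1 * D1 * q * q/2, 0, 0, - 5 * D * P * a * q * q * u * u + D * P * a * q * q * v * v + D1 * P * a * q * q * u],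
      vector [- 6 * D * P * a * q * q * u * v + D1 * P * a * q * q * v, 0, 0, 6 * D * P * q * q * u * v - D1 * P * q * q * v],
      vector [0, a * u * u - a * v * v, - 2 * D * u * v/P + D1 * v/P, 0]],
    vector [
      vector [- D1 * D1/(2 * D * D) + D2/(2 * D) + u * u - v * v, 0, 0, - D1 * P * a * u/(D * D) - P * a * u * u/D + P * a * v * v/D],
      vector [0, D1 * D1/(2 * D * D) - D2/(2 * D) - u * u + v * v, - 2 * a * u * v, 0],
      vector [0, D1 * P * a * v/(D * D) + 2 * P * a * u * v/D, - u * u + v * v, 0],
      vector [- a * u * u + a * v * v, 0, 0, u * u - v * v]],
    vector [
      vector [2 * a * u * v, 0, 0, - 2 * u * v],
      vector [0, - 2 * a * u * v, D * u * u/P - D * v * v/P - D1 * u/P, 0],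
      vector [0, - u * u + v * v, - 2 * a * u * v, 0],
      vector [- 2 * D * u * v/P + D1 * v/P, 0, 0, 2 * a * u * v]],
    vector [
      vector [0, - D1 * P * a * u/(D * D) - P * a * u * u/D + P * a * v * v/D, 2 * u * v, 0],
      vector [- 5 * D * P * a * q * q * u * u + D * P * a * q * q * v * v + D1 * P * a * q * q * u, 0, 0, 5 * D * P * q * q * u * u - D * P * q * q * v * v - D1 * P * q * q * u],
      vector [6 * D * P * q * q * u * v - D1 * P * q * q * v, 0, 0, 2 * P * P1 * q * q * u - 6 * P * P * a * q * q * u * v],
      vector [0, - u * u + v * v, 2 * a * u * v, 0]]]"

text \<open>Likewise in c = cos theta, by u_c = -2auv, v_c = a(u^2 - v^2), q_c = -2avq.\<close>

definition carter_conn_dc :: "real \<Rightarrow> real \<Rightarrow> real \<Rightarrow> real \<Rightarrow> real \<Rightarrow> real \<Rightarrow> real \<Rightarrow> real \<Rightarrow> real \<Rightarrow> real^4^4^4" where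
  "carter_conn_dc a u v q D P D1 P1 P2 = vector [
    vector [
      vector [0, 2 * a * u * v, a * a * u * u - a * a * v * v, 0],
      vector [- 2 * D * D1 * a * q * q * v + 6 * D * D * a * q * q * u * v, 0, 0, - 6 * D * P * a * a * q * q * u * v + D * P1 * a * q * q * u],
      vector [D * P * a * a * q * q * u * u - 5 * D * P * a * a * q * q * v * v + D * P1 * a * q * q * v, 0, 0, - D * P * a * q * q * u * u + 5 * D * P * a * q * q * v * v - D * P1 * q * q * v],
      vector [0, 2 * a * a * u * v, - D * P1 * v/(P * P) + D * a * u * u/P - D * a * v * v/P, 0]],
    vector [
      vector [2 * a * u * v, 0, 0, - 2 * P * a * a * u * v/D + P1 * a * u/D],
      vector [0, - 2 * a * u * v, a * a * u * u - a * a * v * v, 0],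
      vector [0, - P * a * a * u * u/D + P * a * a * v * v/D - P1 * a * v/D, - 2 * a * u * v, 0],
      vector [- 2 * a * a * u * v, 0, 0, 2 * a * u * v]],
    vector [
      vector [- a * a * u * u + a * a * v * v, 0, 0, a * u * u - a * v * v],
      vector [0, a * a * u * u - a * a * v * v, D * P1 * u/(P * P) + 2 * D * a * u * v/P, 0],
      vector [0, - 2 * a * u * v, P1 * P1/(2 * P * P) - P2/(2 * P) + a * a * u * u - a * a * v * v, 0],
      vector [- D * P1 * v/(P * P) + D * a * u * u/P - D * a * v * v/P, 0, 0, - P1 * P1/(2 * P * P) + P2/(2 * P) - a * a * u * u + a * a * v * v]],
    vector [
      vector [0, - 2 * P * a * a * u * v/D + P1 * a * u/D, - a * u * u + a * v * v, 0],
      vector [- 6 * D * P * a * a * q * q * u * v + D * P1 * a * q * q * u, 0, 0, 6 * D * P * a * q * q * u * v - D * P1 * q * q * u],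
      vector [- D * P * a * q * q * u * u + 5 * D * P * a * q * q * v * v - D * P1 * q * q * v, 0, 0, 4 * P * P1 * a * q * q * v - P * P2 * q * q/2 + P * P * a * a * q * q * u * u - 5 * P * P * a * a * q * q * v * v - P1 * P1 * q * q/2],
      vector [0, - 2 * a * u * v, - P1 * P1/(2 * P * P) + P2/(2 * P) - a * a * u * u + a * a * v * v, 0]]]"

definition carter_curvature :: "real \<Rightarrow> real \<Rightarrow> real \<Rightarrow> real \<Rightarrow> real \<Rightarrow> real \<Rightarrow> real \<Rightarrow> real \<Rightarrow> real \<Rightarrow> real \<Rightarrow> 4 tensor4" where
  "carter_curvature a u v q D P D1 P1 D2 P2 = frame_curvature (\<lambda>c. carter_conn a u v q D P D1 P1 $ c)
     (\<lambda>d c. if d = 2 then carter_conn_dr a u v q D P D1 P1 D2 $ c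
        else if d = 3 then carter_conn_dc a u v q D P D1 P1 P2 $ c else 0)"

text \<open>A rational identity in ten independent numbers. \<open>L1\<close> and \<open>L4\<close>
  belong to the planes 12 and 34, \<open>L2\<close> to the four mixed planes, and \<open>L3\<close>
  is the dual part; no field equation has entered yet.\<close>

lemma carter_curvature:
  assumes nz: "D \<noteq> 0" "P \<noteq> 0" "q \<noteq> 0" and h: "h = carter_lengths q D P"
    and L1: "L1 = D * q * (v * v - 3 * u * u) + 2 * D1 * u * q - D2 * q / 2 + a * a * P * q * (3 * u * u - v * v)"
    and L2: "L2 = (D - a * a * P) * q * (u * u - v * v) - q * (D1 * u + a * P1 * v) / 2"
    and L3: "L3 = q * (D1 * v - a * P1 * u) / 2 - 2 * u * v * q * (D - a * a * P)"
    and L4: "L4 = (D - a * a * P) * q * (3 * v * v - u * u) + 2 * a * P1 * v * q - P2 * q / 2"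
  shows "h $ i * carter_curvature a u v q D P D1 P1 D2 P2 i j r s =
    (if {i, j} = {1, 2} then L1 else if {i, j} = {3, 4} then L4 else L2) * area_form (diag_mat h) i j r s
    + (if (i \<in> {1, 2}) = (j \<in> {1, 2}) then 2 else -1) * L3 * permutation_symbol i j r s"
proof -
  have "\<forall>i j. h $ i * carter_curvature a u v q D P D1 P1 D2 P2 i j r s =
    (if {i, j} = {1, 2} then L1 else if {i, j} = {3, 4} then L4 else L2) * area_form (diag_mat h) i j r s
    + (if (i \<in> {1, 2}) = (j \<in> {1, 2}) then 2 else -1) * L3 * permutation_symbol i j r s"
    unfolding forall_4 using exhaust_4[of r] exhaust_4[of s]
    by (elim disjE; clarsimp simp: h carter_lengths_def area_form_def diag_mat_nth doubleton_eq_iff carter_curvature_def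
        frame_curvature_def matrix_entry_mult sum_4 carter_conn_def carter_conn_dr_def carter_conn_dc_def;
        (intro conjI)?; simp add: nz L1 L2 L3 L4 field_simps)
  then show ?thesis by blast
qed

lemma carter_compat:
  assumes nz: "D \<noteq> 0" "P \<noteq> 0" "q \<noteq> 0"
  shows "(if c = 2 then diag_mat (vector [- (D1 * q) + 2 * D * u * q, 2 * u / (q * D) - D1 / (q * D * D), 2 * u / (q * P), - (2 * P * u * q)])
     else if c = 3 then diag_mat (vector [2 * D * a * v * q, 2 * a * v / (q * D), 2 * a * v / (q * P) - P1 / (q * P * P), P1 * q - 2 * P * a * v * q])
     else 0) = diag_mat (carter_lengths q D P) ** (carter_conn a u v q D P D1 P1 $ c) + transpose (carter_conn a u v q D P D1 P1 $ c) ** diag_mat (carter_lengths q D P)"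
proof -
  have "c = 1 \<or> c = 2 \<or> c = 3 \<or> c = 4" by (rule exhaust_4)
  then show ?thesis
    unfolding vec_eq_iff forall_4
    by (elim disjE; clarsimp simp: carter_lengths_def diag_mat_nth matrix_entry_mult sum_4 transpose_def carter_conn_def;
        (intro conjI)?; simp add: nz field_simps)
qed

section \<open>The metric functions and their derivatives\<close>

locale kerr =
  fixes a \<Lambda> m :: real
  assumes Xi: "Xi a \<Lambda> \<noteq> 0"
begin

definition S :: "real^4 \<Rightarrow> real" where "S y = (y $ 2)\<^sup>2 + a\<^sup>2 * (cos (y $ 3))\<^sup>2"
definition q :: "real^4 \<Rightarrow> real" where "q y = 1 / S y"
definition u :: "real^4 \<Rightarrow> real" where "u y = y $ 2 / S y"
definition v :: "real^4 \<Rightarrow> real" where "v y = a * cos (y $ 3) / S y"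
definition D :: "real^4 \<Rightarrow> real" where
  "D y = (1 - \<Lambda> / 3 * (y $ 2)\<^sup>2) * ((y $ 2)\<^sup>2 + a\<^sup>2) - 2 * m * y $ 2"
text \<open>The cube is split into a product because the derivative rules cover products and squares
  only.\<close>

definition D1 :: "real^4 \<Rightarrow> real" where
  "D1 y = 2 * y $ 2 * (1 - a\<^sup>2 * \<Lambda> / 3) - 4 * \<Lambda> / 3 * (y $ 2 * (y $ 2)\<^sup>2) - 2 * m"
definition D2 :: "real^4 \<Rightarrow> real" where
  "D2 y = 2 * (1 - a\<^sup>2 * \<Lambda> / 3) - 4 * \<Lambda> * (y $ 2)\<^sup>2"
definition P :: "real^4 \<Rightarrow> real" where
  "P y = (1 - (cos (y $ 3))\<^sup>2) * (1 + a\<^sup>2 * \<Lambda> / 3 * (cos (y $ 3))\<^sup>2)"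
definition P1 :: "real^4 \<Rightarrow> real" where
  "P1 y = 2 * cos (y $ 3) * (a\<^sup>2 * \<Lambda> / 3 - 1) - 4 * a\<^sup>2 * \<Lambda> / 3 * (cos (y $ 3) * (cos (y $ 3))\<^sup>2)"
definition P2 :: "real^4 \<Rightarrow> real" where
  "P2 y = 2 * (a\<^sup>2 * \<Lambda> / 3 - 1) - 4 * a\<^sup>2 * \<Lambda> * (cos (y $ 3))\<^sup>2"

definition U :: "(real^4) set" where
  "U = {y. S y \<noteq> 0 \<and> D y \<noteq> 0 \<and> P y \<noteq> 0 \<and> sin (y $ 3) \<noteq> 0}"

lemma nonzero:
  assumes "y \<in> U"
  shows "S y \<noteq> 0" "D y \<noteq> 0" "P y \<noteq> 0" "sin (y $ 3) \<noteq> 0" "q y \<noteq> 0"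
  using assms by (auto simp: U_def q_def)

lemma open_U: "open U"
  unfolding U_def S_def D_def P_def
  by (intro open_Collect_conj open_Collect_neq continuous_intros)

lemma q_eq: "y \<in> U \<Longrightarrow> q y = (u y)\<^sup>2 + (v y)\<^sup>2"
  using nonzero(1)[of y] by (simp add: q_def u_def v_def power_divide add_divide_distrib[symmetric] power_mult_distrib S_def[symmetric])
     (simp add: power2_eq_square)

text \<open>The first two are the real and imaginary parts of the derivatives -1/zeta^2 in r and i
  a/zeta^2 in cos theta of 1/zeta; q is |1/zeta|^2.\<close>

lemma partials:
  assumes "y \<in> U"
  shows "has_rc_partials u (v y * v y - u y * u y) (- 2 * a * u y * v y) y"
    and "has_rc_partials v (- 2 * u y * v y) (a * (u y * u y - v y * v y)) y"
    and "has_rc_partials q (- 2 * u y * q y) (- 2 * a * v y * q y) y"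
    and "has_rc_partials D (D1 y) 0 y" "has_rc_partials D1 (D2 y) 0 y"
    and "has_rc_partials P 0 (P1 y) y" "has_rc_partials P1 0 (P2 y) y"
proof -
  have S: "has_rc_partials S (2 * y $ 2) (2 * a\<^sup>2 * cos (y $ 3)) y"
    unfolding S_def
    by (rule has_rc_partials_eqI, ((rule has_rc_partials_intros)+)[1]) simp_all
  have Snz: "S y \<noteq> 0" using nonzero[OF assms] by simp
  have three: "(3::real) \<noteq> 0" by simp
  show "has_rc_partials u (v y * v y - u y * u y) (- 2 * a * u y * v y) y"
    unfolding u_def v_def
    by (rule has_rc_partials_eqI, ((rule has_rc_partials_intros S Snz)+)[1]; simp add: Snz field_simps;
        (simp add: S_def power2_eq_square algebra_simps)?)
  show "has_rc_partials v (- 2 * u y * v y) (a * (u y * u y - v y * v y)) y"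
    unfolding u_def v_def
    by (rule has_rc_partials_eqI, ((rule has_rc_partials_intros S Snz)+)[1]; simp add: Snz field_simps;
        (simp add: S_def power2_eq_square algebra_simps)?)
  show "has_rc_partials q (- 2 * u y * q y) (- 2 * a * v y * q y) y"
    unfolding u_def v_def q_def
    by (rule has_rc_partials_eqI, ((rule has_rc_partials_intros S Snz)+)[1]; simp add: Snz field_simps;
        (simp add: S_def power2_eq_square algebra_simps)?)
  show "has_rc_partials D (D1 y) 0 y" unfolding D_def D1_def
    by (rule has_rc_partials_eqI, ((rule has_rc_partials_intros three)+)[1]) (simp_all add: field_simps power2_eq_square)
  show "has_rc_partials D1 (D2 y) 0 y" unfolding D2_def D1_def
    by (rule has_rc_partials_eqI, ((rule has_rc_partials_intros three)+)[1]) (simp_all add: field_simps power2_eq_square)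
  show "has_rc_partials P 0 (P1 y) y" unfolding P_def P1_def
    by (rule has_rc_partials_eqI, ((rule has_rc_partials_intros three)+)[1]) (simp_all add: field_simps power2_eq_square)
  show "has_rc_partials P1 0 (P2 y) y" unfolding P2_def P1_def
    by (rule has_rc_partials_eqI, ((rule has_rc_partials_intros three)+)[1]) (simp_all add: field_simps power2_eq_square)
qed

definition lengths :: "real^4 \<Rightarrow> real^4" where "lengths y = carter_lengths (q y) (D y) (P y)"
definition conn :: "real^4 \<Rightarrow> 4 \<Rightarrow> real^4^4" where
  "conn y c = carter_conn a (u y) (v y) (q y) (D y) (P y) (D1 y) (P1 y) $ c"
definition dconn :: "real^4 \<Rightarrow> 4 \<Rightarrow> 4 \<Rightarrow> real^4^4" where
  "dconn y d c = (if d = 2 then carter_conn_dr a (u y) (v y) (q y) (D y) (P y) (D1 y) (P1 y) (D2 y) $ c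
    else if d = 3 then carter_conn_dc a (u y) (v y) (q y) (D y) (P y) (D1 y) (P1 y) (P2 y) $ c else 0)"
text \<open>Taken from the compatibility equation, so that the content moves to
  \<open>lengths_partials\<close>: this really is the derivative of the lengths.\<close>

definition dlengths :: "real^4 \<Rightarrow> 4 \<Rightarrow> real^4^4" where
  "dlengths y c = diag_mat (lengths y) ** conn y c + transpose (conn y c) ** diag_mat (lengths y)"

lemma conn_partials:
  assumes y: "y \<in> U"
  shows "has_rc_partials (\<lambda>y. conn y c $ i $ j) (dconn y 2 c $ i $ j) (dconn y 3 c $ i $ j) y"
proof -
  have *: "2 * D y \<noteq> 0" "2 * P y \<noteq> 0" "(2::real) \<noteq> 0" using nonzero[OF y] by auto
  have three_neq_two: "((3::4) = 2) = False" by simp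
  have "\<forall>i j. has_rc_partials (\<lambda>y. conn y c $ i $ j) (dconn y 2 c $ i $ j) (dconn y 3 c $ i $ j) y"
    unfolding forall_4
    by (insert exhaust_4[of c], elim disjE; hypsubst; simp only: conn_def dconn_def carter_conn_def carter_conn_dr_def
          carter_conn_dc_def vector_4 if_True if_False simp_thms three_neq_two; intro conjI;
        (rule has_rc_partials_eqI, ((rule has_rc_partials_intros partials y nonzero *)+)[1]))
       (simp_all add: nonzero[OF y] field_simps)
  then show ?thesis by blast
qed

text \<open>Here the particular \<open>D\<close> and \<open>P\<close> enter: the right-hand sides
  are \<open>L1\<close> to \<open>L4\<close> of \<open>carter_curvature\<close>, and X + iY = m (u +
  iv)^3.\<close>

lemma einstein_type_D:
  assumes "y \<in> U"
  defines "X \<equiv> m * (u y * u y * u y - 3 * u y * v y * v y)" and "Y \<equiv> m * (3 * u y * u y * v y - v y * v y * v y)"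
  shows "2 * X + \<Lambda> / 3 = D y * q y * (v y * v y - 3 * u y * u y) + 2 * D1 y * u y * q y - D2 y * q y / 2 + a * a * P y * q y * (3 * u y * u y - v y * v y)"
    and "\<Lambda> / 3 - X = (D y - a * a * P y) * q y * (u y * u y - v y * v y) - q y * (D1 y * u y + a * P1 y * v y) / 2"
    and "Y = q y * (D1 y * v y - a * P1 y * u y) / 2 - 2 * u y * v y * q y * (D y - a * a * P y)"
    and "2 * X + \<Lambda> / 3 = (D y - a * a * P y) * q y * (3 * v y * v y - u y * u y) + 2 * a * P1 y * v y * q y - P2 y * q y / 2"
proof -
  define r c where "r = y $ 2" and "c = cos (y $ 3)"
  have S: "S y = r * r + a * a * (c * c)" by (simp add: S_def r_def c_def power2_eq_square)
  have nz: "S y \<noteq> 0" using nonzero[OF assms(1)] by simp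
  \<comment> \<open>After eliminating u and v, each claim is a polynomial identity modulo
    \<open>q y * S y = 1\<close>.\<close>
  have 1: "q y * S y = 1" "u y = r * q y" "v y = a * c * q y"
    using nz by (simp_all add: u_def v_def q_def r_def c_def)
  note defs = D_def D1_def D2_def P_def P1_def P2_def r_def[symmetric] c_def[symmetric]
  show "2 * X + \<Lambda> / 3 = D y * q y * (v y * v y - 3 * u y * u y) + 2 * D1 y * u y * q y - D2 y * q y / 2 + a * a * P y * q y * (3 * u y * u y - v y * v y)"
    using 1(1) unfolding X_def 1(2,3) defs S by algebra
  show "\<Lambda> / 3 - X = (D y - a * a * P y) * q y * (u y * u y - v y * v y) - q y * (D1 y * u y + a * P1 y * v y) / 2"
    using 1(1) unfolding X_def 1(2,3) defs S by algebra
  show "Y = q y * (D1 y * v y - a * P1 y * u y) / 2 - 2 * u y * v y * q y * (D y - a * a * P y)"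
    using 1(1) unfolding Y_def 1(2,3) defs S by algebra
  show "2 * X + \<Lambda> / 3 = (D y - a * a * P y) * q y * (3 * v y * v y - u y * u y) + 2 * a * P1 y * v y * q y - P2 y * q y / 2"
    using 1(1) unfolding X_def 1(2,3) defs S by algebra
qed

section \<open>The Carter coframe satisfies the structure equations\<close>

definition E :: "real^4 \<Rightarrow> real^4^4" where
  "E y = vector [
    vector [1 / Xi a \<Lambda>, 0, 0, - (a * (1 - (cos (y $ 3))\<^sup>2) / Xi a \<Lambda>)],
    vector [0, 1, 0, 0],
    vector [0, 0, - sin (y $ 3), 0],
    vector [a / Xi a \<Lambda>, 0, 0, - (((y $ 2)\<^sup>2 + a\<^sup>2) / Xi a \<Lambda>)]]"

definition F :: "real^4 \<Rightarrow> real^4^4" where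
  "F y = vector [
    vector [Xi a \<Lambda> * ((y $ 2)\<^sup>2 + a\<^sup>2) / S y, 0, 0, - (Xi a \<Lambda> * a * (1 - (cos (y $ 3))\<^sup>2) / S y)],
    vector [0, 1, 0, 0],
    vector [0, 0, - (1 / sin (y $ 3)), 0],
    vector [Xi a \<Lambda> * a / S y, 0, 0, - (Xi a \<Lambda> / S y)]]"

definition dE :: "real^4 \<Rightarrow> 4 \<Rightarrow> real^4^4" where
  "dE y i = (if i = 2 then vector [0, 0, 0, vector [0, 0, 0, - (2 * y $ 2 / Xi a \<Lambda>)]]
    else if i = 3 then vector [vector [0, 0, 0, - (2 * a * sin (y $ 3) * cos (y $ 3) / Xi a \<Lambda>)], 0,
      vector [0, 0, - cos (y $ 3), 0], 0]
    else 0)"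

definition ddE :: "real^4 \<Rightarrow> 4 \<Rightarrow> 4 \<Rightarrow> real^4^4" where
  "ddE y i j = (if i = 2 \<and> j = 2 then vector [0, 0, 0, vector [0, 0, 0, - (2 / Xi a \<Lambda>)]]
    else if i = 3 \<and> j = 3 then vector [vector [0, 0, 0, - (2 * a * ((cos (y $ 3))\<^sup>2 - (sin (y $ 3))\<^sup>2) / Xi a \<Lambda>)], 0,
      vector [0, 0, sin (y $ 3), 0], 0]
    else 0)"

lemma FE: "y \<in> U \<Longrightarrow> F y ** E y = mat 1"
  using nonzero[of y] Xi
  by (simp add: vec_eq_iff forall_4 matrix_entry_mult sum_4 E_def F_def mat_def field_simps)
     (simp add: S_def power2_eq_square algebra_simps)

lemma deriv_E: "has_partial i E (dE y i) y"
proof (rule has_partial_matrix)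
  have "\<forall>j k. ((\<lambda>h. E (y + h *\<^sub>R axis i 1) $ j $ k) has_real_derivative dE y i $ j $ k) (at 0)"
    unfolding forall_4
    by (insert exhaust_4[of i], elim disjE; simp add: E_def dE_def axis_def; (intro conjI)?;
       (auto intro!: derivative_eq_intros simp: Xi field_simps power2_eq_square)?)
  then show "((\<lambda>h. E (y + h *\<^sub>R axis i 1) $ j $ k) has_real_derivative dE y i $ j $ k) (at 0)" for j k by blast
qed

lemma deriv_dE: "has_partial i (\<lambda>y. dE y j) (ddE y i j) y"
proof (rule has_partial_matrix)
  have "\<forall>k l. ((\<lambda>h. dE (y + h *\<^sub>R axis i 1) j $ k $ l) has_real_derivative ddE y i j $ k $ l) (at 0)"
    unfolding forall_4
    by (insert exhaust_4[of i] exhaust_4[of j], elim disjE; simp add: ddE_def dE_def axis_def; (intro conjI)?;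
       (auto intro!: derivative_eq_intros simp: Xi field_simps power2_eq_square)?)
  then show "((\<lambda>h. dE (y + h *\<^sub>R axis i 1) j $ k $ l) has_real_derivative ddE y i j $ k $ l) (at 0)" for k l by blast
qed

lemma deriv_F:
  assumes y: "y \<in> U"
  shows "has_partial i F (- (F y ** dE y i ** F y)) y"
proof (rule has_partial_matrix)
  have nz: "(y $ 2)\<^sup>2 + a\<^sup>2 * (cos (y $ 3))\<^sup>2 \<noteq> 0" "sin (y $ 3) \<noteq> 0"
    using nonzero[OF y] by (auto simp: S_def)
  have "\<forall>k l. ((\<lambda>h. F (y + h *\<^sub>R axis i 1) $ k $ l) has_real_derivative (- (F y ** dE y i ** F y)) $ k $ l) (at 0)"
    unfolding forall_4
    by (insert exhaust_4[of i], elim disjE; simp add: F_def dE_def axis_def matrix_entry_mult sum_4 S_def; (intro conjI)?;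
       (auto intro!: derivative_eq_intros simp: nz)?; (simp add: nz field_simps)?; (simp add: power2_eq_square algebra_simps)?;
       (simp add: minus_divide_left del: divide_minus_left)?)
  then show "((\<lambda>h. F (y + h *\<^sub>R axis i 1) $ k $ l) has_real_derivative (- (F y ** dE y i ** F y)) $ k $ l) (at 0)" for k l by blast
qed

text \<open>Rows two and three of \<open>E\<close> are dr and d(cos theta), so these two frame
  derivatives produce every coordinate derivative.\<close>

lemma has_partial_frame:
  assumes "has_rc_partials f (df 2) (df 3) y" "df 1 = 0" "df 4 = 0"
  shows "has_partial i f (\<Sum>c\<in>UNIV. E y $ c $ i * df c) y"
  using assms(1)[unfolded has_rc_partials_def, rule_format, of i] assms(2,3)
  by (insert exhaust_4[of i], elim disjE; simp add: sum_4 E_def)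

lemma deriv_conn:
  assumes "y \<in> U"
  shows "has_partial i (\<lambda>y. conn y c) (\<Sum>d\<in>UNIV. E y $ d $ i *\<^sub>R dconn y d c) y"
proof (intro has_partial_vec)
  fix k l
  have "has_partial i (\<lambda>y. conn y c $ k $ l) (\<Sum>d\<in>UNIV. E y $ d $ i * dconn y d c $ k $ l) y"
    by (rule has_partial_frame[where df = "\<lambda>d. dconn y d c $ k $ l"]) (simp_all add: conn_partials assms, simp_all add: dconn_def)
  then show "has_partial i (\<lambda>y. conn y c $ k $ l) ((\<Sum>d\<in>UNIV. E y $ d $ i *\<^sub>R dconn y d c) $ k $ l) y"
    by simp
qed

lemma lengths_partials:
  assumes y: "y \<in> U"
  shows "has_partial i (\<lambda>y. diag_mat (lengths y)) (\<Sum>c\<in>UNIV. E y $ c $ i *\<^sub>R dlengths y c) y"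
proof (intro has_partial_vec)
  fix k l
  have *: "q y * D y \<noteq> 0" "q y * P y \<noteq> 0" using nonzero[OF y] by auto
  have dl: "dlengths y c = (if c = 2 then diag_mat (vector [- (D1 y * q y) + 2 * D y * u y * q y,
        2 * u y / (q y * D y) - D1 y / (q y * D y * D y), 2 * u y / (q y * P y), - (2 * P y * u y * q y)])
     else if c = 3 then diag_mat (vector [2 * D y * a * v y * q y, 2 * a * v y / (q y * D y),
        2 * a * v y / (q y * P y) - P1 y / (q y * P y * P y), P1 y * q y - 2 * P y * a * v y * q y])
     else 0)" for c
    unfolding dlengths_def lengths_def conn_def using carter_compat[of "D y" "P y" "q y" c "D1 y" "u y" a "v y" "P1 y"] nonzero[OF y] by simp
  have "\<forall>k l. has_rc_partials (\<lambda>y. diag_mat (lengths y) $ k $ l) (dlengths y 2 $ k $ l) (dlengths y 3 $ k $ l) y"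
    unfolding forall_4
    by (simp add: dl diag_mat_nth lengths_def carter_lengths_def; intro conjI;
        (rule has_rc_partials_eqI, ((rule has_rc_partials_intros partials y nonzero *)+)[1]))
       (simp_all add: nonzero[OF y] field_simps)
  then have "has_partial i (\<lambda>y. diag_mat (lengths y) $ k $ l) (\<Sum>c\<in>UNIV. E y $ c $ i * dlengths y c $ k $ l) y"
    by (intro has_partial_frame[where df = "\<lambda>c. dlengths y c $ k $ l"]) (simp_all, simp_all add: dl)
  then show "has_partial i (\<lambda>y. diag_mat (lengths y) $ k $ l) ((\<Sum>c\<in>UNIV. E y $ c $ i *\<^sub>R dlengths y c) $ k $ l) y"
    by simp
qed

lemma torsion:
  assumes y: "y \<in> U"
  shows "dE y i $ f $ j - dE y j $ f $ i =
      (\<Sum>c\<in>UNIV. \<Sum>d\<in>UNIV. (conn y d $ f $ c - conn y c $ f $ d) * E y $ c $ i * E y $ d $ j)"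
proof -
  have "\<forall>f. dE y i $ f $ j - dE y j $ f $ i =
      (\<Sum>c\<in>UNIV. \<Sum>d\<in>UNIV. (conn y d $ f $ c - conn y c $ f $ d) * E y $ c $ i * E y $ d $ j)"
    unfolding forall_4
    by (insert exhaust_4[of i] exhaust_4[of j], elim disjE; simp add: dE_def E_def sum_4 conn_def carter_conn_def;
       (simp add: u_def v_def nonzero[OF y] Xi field_simps)?; (simp add: S_def power2_eq_square algebra_simps)?)
  then show ?thesis by blast
qed

lemma metric:
  assumes y: "y \<in> U"
  shows "kerr_ads a \<Lambda> m y = transpose (E y) ** diag_mat (lengths y) ** E y"
proof -
  have S: "rho_sq a (y $ 2) (y $ 3) = S y" by (simp add: rho_sq_def S_def)
  have D: "Delta_r a \<Lambda> m (y $ 2) = D y" by (simp add: Delta_r_def D_def)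
  have P: "P y = (sin (y $ 3))\<^sup>2 * Delta_theta a \<Lambda> (y $ 3)" by (simp add: P_def Delta_theta_def sin_squared_eq)
  have nz: "Delta_theta a \<Lambda> (y $ 3) \<noteq> 0" using nonzero(3)[OF y] by (auto simp: P)
  show ?thesis
    by (simp add: vec_eq_iff forall_4 kerr_ads_def Let_def S D axis_def matrix_entry_mult sum_4 transpose_def diag_mat_nth
         lengths_def carter_lengths_def E_def q_def P nonzero[OF y] nz Xi cos_squared_eq; simp add: nonzero[OF y] nz Xi field_simps power2_eq_square)
qed

sublocale moving_frame "kerr_ads a \<Lambda> m" U E F dE ddE "\<lambda>y. diag_mat (lengths y)" dlengths conn dconn
proof
  show "\<exists>K. K ** diag_mat (lengths y) = mat 1" if "y \<in> U" for y
    using nonzero[OF that]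
    by (intro exI[of _ "diag_mat (\<chi> i. 1 / lengths y $ i)"])
       (simp add: vec_eq_iff forall_4 matrix_entry_mult sum_4 diag_mat_nth mat_def lengths_def carter_lengths_def)
  show "ddE y i j = ddE y j i" for y i j by (simp add: ddE_def)
  show "dlengths y c = diag_mat (lengths y) ** conn y c + transpose (conn y c) ** diag_mat (lengths y)" for y c
    by (simp add: dlengths_def)
qed (simp_all add: open_U FE metric deriv_E deriv_dE deriv_F deriv_conn lengths_partials torsion)

section \<open>The scalar invariants and their gradients\<close>

definition X :: "real^4 \<Rightarrow> real" where "X y = m * (u y * u y * u y - 3 * u y * v y * v y)"
definition Y :: "real^4 \<Rightarrow> real" where "Y y = m * (3 * u y * u y * v y - v y * v y * v y)"

lemma lengths_products:
  assumes "y \<in> U"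
  shows "lengths y $ 1 * lengths y $ 2 = -1" "lengths y $ 3 * lengths y $ 4 = 1"
  using nonzero[OF assms] by (simp_all add: lengths_def carter_lengths_def)

lemma frame_curvature_type_D:
  assumes y: "y \<in> U"
  shows "lengths y $ i * frame_curvature (conn y) (dconn y) i j r s
    = type_D (lengths y) (X y) (Y y) i j r s + \<Lambda> / 3 * area_form (diag_mat (lengths y)) i j r s"
proof -
  have K: "frame_curvature (conn y) (dconn y) = carter_curvature a (u y) (v y) (q y) (D y) (P y) (D1 y) (P1 y) (D2 y) (P2 y)"
    unfolding carter_curvature_def conn_def[abs_def] dconn_def[abs_def] ..
  \<comment> \<open>For i = j the two descriptions assign different weights, \<open>L2\<close>
    against 2; skewness makes both sides vanish.\<close>
  have skew: "area_form H i i r s = 0" for H :: "real^4^4" and i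
    by (simp add: area_form_def)
  show ?thesis
    unfolding K carter_curvature[OF nonzero(2)[OF y] nonzero(3)[OF y] nonzero(5)[OF y] lengths_def
        einstein_type_D[OF y, folded X_def Y_def]] type_D_def
    by (insert exhaust_4[of i] exhaust_4[of j], elim disjE; simp add: skew doubleton_eq_iff; simp add: algebra_simps)
qed

lemma sgn_det_E: "y \<in> U \<Longrightarrow> sgn (det (E y)) = sgn (sin (y $ 3))"
proof -
  assume y: "y \<in> U"
  have "det (E y) = sin (y $ 3) * (S y / (Xi a \<Lambda>)\<^sup>2)"
    using Xi by (simp add: det_4 E_def S_def field_simps power2_eq_square)
  moreover have "S y / (Xi a \<Lambda>)\<^sup>2 > 0"
    using nonzero(1)[OF y] Xi by (simp add: S_def order_less_le)
  ultimately show ?thesis by (simp only: sgn_mult sgn_pos mult_1_right)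
qed

lemma invariants:
  assumes y: "y \<in> U"
  shows "inv_metric (kerr_ads a \<Lambda> m) y = F y ** diag_mat (\<chi> i. 1 / lengths y $ i) ** transpose (F y)"
    and "I1 (kerr_ads a \<Lambda> m) y = 48 * ((X y)\<^sup>2 - (Y y)\<^sup>2)"
    and "I2 (kerr_ads a \<Lambda> m) y = - 96 * sgn (sin (y $ 3)) * (X y * Y y)"
  using type_D_invariants[OF FE[OF y] metric[OF y] lengths_products[OF y] riemann_frame[OF y] frame_curvature_type_D[OF y]]
  by (simp_all add: sgn_det_E[OF y])

text \<open>Real and imaginary parts of Z_r = -3 Z/zeta and Z_c = 3 i a Z/zeta for Z =
  m/zeta^3.\<close>

lemma XY_partials:
  assumes y: "y \<in> U"
  shows "has_rc_partials X (- 3 * (u y * X y - v y * Y y)) (- 3 * a * (u y * Y y + v y * X y)) y"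
    and "has_rc_partials Y (- 3 * (u y * Y y + v y * X y)) (3 * a * (u y * X y - v y * Y y)) y"
  unfolding X_def Y_def
  by (rule has_rc_partials_eqI, ((rule has_rc_partials_intros partials y)+)[1]; simp add: algebra_simps)+

text \<open>The second and third frame vectors have inverse squared lengths \<open>q y * D y\<close>
  and \<open>q y * P y\<close>; the factor - sin theta of the chain rule cancels against
  \<open>F\<close>.\<close>

lemma gradient_norm:
  assumes y: "y \<in> U" and f: "has_rc_partials f fr fc y"
  shows "(\<Sum>\<mu>\<in>UNIV. \<Sum>\<nu>\<in>UNIV. inv_metric (kerr_ads a \<Lambda> m) y $ \<mu> $ \<nu> * - partial \<mu> f y * - partial \<nu> f y)
    = q y * (D y * fr\<^sup>2 + P y * fc\<^sup>2)"
proof -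
  have p: "partial i f y = (if i = 2 then fr else if i = 3 then - sin (y $ 3) * fc else 0)" for i
    using f by (intro has_partial_imp_partial) (simp add: has_rc_partials_def)
  show ?thesis
    unfolding invariants(1)[OF y] sum_4 p
    using nonzero[OF y]
    by (simp add: matrix_entry_mult sum_4 transpose_def diag_mat_nth F_def lengths_def carter_lengths_def)
       (simp add: field_simps power2_eq_square)
qed

lemma Q3_kerr:
  assumes y: "y \<in> U" and m: "m > 0"
  shows "Q3 (kerr_ads a \<Lambda> m) y = (D y + a\<^sup>2 * P y) * sqrt (q y) / (2 * m)"
proof -
  define \<sigma> where "\<sigma> = sgn (sin (y $ 3))"
  have \<sigma>: "\<sigma> * \<sigma> = 1" using nonzero(4)[OF y] by (simp add: \<sigma>_def sgn_mult_self_eq)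
  \<comment> \<open>Real parts of the derivatives -288 Z^2/zeta and 288 i a Z^2/zeta of 48
    Z^2.\<close>
  have I1': "has_rc_partials (I1 (kerr_ads a \<Lambda> m))
      (- 288 * (u y * ((X y)\<^sup>2 - (Y y)\<^sup>2) - 2 * v y * (X y * Y y)))
      (- 288 * a * (v y * ((X y)\<^sup>2 - (Y y)\<^sup>2) + 2 * u y * (X y * Y y))) y"
    by (subst has_rc_partials_cong[OF open_U y invariants(2)], assumption)
       (rule has_rc_partials_eqI, ((rule has_rc_partials_intros XY_partials y)+)[1], simp_all add: algebra_simps power2_eq_square)
  \<comment> \<open>On this neighbourhood sin theta keeps its sign, so the sign in \<open>I2\<close>
    is constant and can be differentiated past.\<close>
  define V where "V = U \<inter> {z. sin (z $ 3) * sin (y $ 3) > 0}"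
  have V: "open V"
    unfolding V_def by (intro open_Int open_U open_Collect_less continuous_intros)
  have yV: "y \<in> V"
    using nonzero(4)[OF y] y by (auto simp: V_def zero_less_mult_iff)
  have I2_V: "I2 (kerr_ads a \<Lambda> m) z = - 96 * \<sigma> * (X z * Y z)" if "z \<in> V" for z
    using that invariants(3)[of z] by (auto simp: V_def \<sigma>_def zero_less_mult_iff)
  have I2': "has_rc_partials (I2 (kerr_ads a \<Lambda> m))
      (\<sigma> * (288 * (v y * ((X y)\<^sup>2 - (Y y)\<^sup>2) + 2 * u y * (X y * Y y))))
      (\<sigma> * (- 288 * a * (u y * ((X y)\<^sup>2 - (Y y)\<^sup>2) - 2 * v y * (X y * Y y)))) y"
    by (subst has_rc_partials_cong[OF V yV I2_V], assumption)
       (rule has_rc_partials_eqI, ((rule has_rc_partials_intros XY_partials y)+)[1], simp_all add: algebra_simps power2_eq_square)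
  have qpos: "q y > 0"
    using nonzero(1)[OF y] by (simp add: q_def S_def order_less_le)
  have norm: "(X y)\<^sup>2 + (Y y)\<^sup>2 = m\<^sup>2 * (q y) ^ 3"
    unfolding q_eq[OF y] X_def Y_def by algebra
  \<comment> \<open>Chosen with k^2 = 48 |Z|^2, so that I_1^2 + I_2^2 = k^4 and the power 5/4
    becomes k^5.\<close>
  define k where "k = 4 * sqrt 3 * m * q y * sqrt (q y)"
  have k: "k > 0" "k\<^sup>2 = 48 * m\<^sup>2 * q y ^ 3"
    using m qpos by (simp_all add: k_def power_mult_distrib) (simp add: power2_eq_square power3_eq_cube)
  have "(I1 (kerr_ads a \<Lambda> m) y)\<^sup>2 + (I2 (kerr_ads a \<Lambda> m) y)\<^sup>2
      = (48 * ((X y)\<^sup>2 - (Y y)\<^sup>2))\<^sup>2 + (\<sigma> * \<sigma>) * (96 * (X y * Y y))\<^sup>2"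
    unfolding invariants[OF y] \<sigma>_def[symmetric] by (simp add: power2_eq_square algebra_simps)
  also have "\<dots> = (48 * ((X y)\<^sup>2 + (Y y)\<^sup>2))\<^sup>2"
    unfolding \<sigma> by algebra
  also have "\<dots> = (k\<^sup>2)\<^sup>2"
    unfolding norm k by (simp add: mult.assoc)
  also have "\<dots> = k powr 4"
    using k(1) by (simp add: powr_numeral)
  finally have "((I1 (kerr_ads a \<Lambda> m) y)\<^sup>2 + (I2 (kerr_ads a \<Lambda> m) y)\<^sup>2) powr (5/4) = (k powr 4) powr (5/4)"
    by simp
  also have "\<dots> = k powr 5"
    by (simp add: powr_powr)
  also have "k powr 5 = k ^ 5"
    using k(1) by (simp add: powr_numeral)
  also have "\<dots> = k * (k\<^sup>2)\<^sup>2"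
    by algebra
  finally have denom: "((I1 (kerr_ads a \<Lambda> m) y)\<^sup>2 + (I2 (kerr_ads a \<Lambda> m) y)\<^sup>2) powr (5/4) = k * (48 * m\<^sup>2 * q y ^ 3)\<^sup>2"
    unfolding k(2) .
  define A B where "A = (X y)\<^sup>2 - (Y y)\<^sup>2" and "B = 2 * (X y * Y y)"
  have "I5 (kerr_ads a \<Lambda> m) y + I6 (kerr_ads a \<Lambda> m) y = q y * (D y * (- 288 * (u y * A - v y * B))\<^sup>2 + P y * (- 288 * a * (v y * A + u y * B))\<^sup>2)
    + q y * (D y * (\<sigma> * (288 * (v y * A + u y * B)))\<^sup>2 + P y * (\<sigma> * (- 288 * a * (u y * A - v y * B)))\<^sup>2)"
    unfolding I5_def I6_def k_covector_def l_covector_def gradient_norm[OF y I1'] gradient_norm[OF y I2'] A_def B_def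
    by (simp add: mult_ac)
  \<comment> \<open>82944 = 288^2. The sum over real and imaginary parts is the squared modulus of
    Z^2/zeta, with Z^2 = A + iB.\<close>
  also have "\<dots> = 82944 * q y * (D y + a\<^sup>2 * P y) * (((u y)\<^sup>2 + (v y)\<^sup>2) * (A\<^sup>2 + B\<^sup>2))"
    unfolding power_mult_distrib[of \<sigma>] power2_eq_square[of \<sigma>] \<sigma> by algebra
  also have "A\<^sup>2 + B\<^sup>2 = ((X y)\<^sup>2 + (Y y)\<^sup>2)\<^sup>2"
    unfolding A_def B_def by algebra
  finally have num: "I5 (kerr_ads a \<Lambda> m) y + I6 (kerr_ads a \<Lambda> m) y = 82944 * (D y + a\<^sup>2 * P y) * (q y)\<^sup>2 * (m\<^sup>2 * q y ^ 3)\<^sup>2"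
    unfolding q_eq[OF y, symmetric] norm by (simp add: power2_eq_square)
  have "Q3 (kerr_ads a \<Lambda> m) y = 82944 * (D y + a\<^sup>2 * P y) * (q y)\<^sup>2 * (m\<^sup>2 * q y ^ 3)\<^sup>2
      / (24 * (sqrt 3 * sqrt 3) * (m * q y * sqrt (q y) * (48 * m\<^sup>2 * q y ^ 3)\<^sup>2))"
    unfolding Q3_def num denom k_def by (simp only: times_divide_times_eq mult_1_left)
  also have "\<dots> = (D y + a\<^sup>2 * P y) * (q y / sqrt (q y)) / (2 * m)"
    using m qpos by (simp add: field_simps power2_eq_square power3_eq_cube)
  also have "\<dots> = (D y + a\<^sup>2 * P y) * sqrt (q y) / (2 * m)"
    using qpos by (simp add: real_div_sqrt)
  finally show ?thesis .
qed

end

theorem theorem32: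
  fixes a \<Lambda> m t r \<theta> \<phi> :: real
  assumes "m > 0"
    and "rho_sq a r \<theta> \<noteq> 0"
    and "Delta_r a \<Lambda> m r \<noteq> 0"
    and "Delta_theta a \<Lambda> \<theta> > 0"
    and "Xi a \<Lambda> \<noteq> 0"
    and "sin \<theta> \<noteq> 0"
  shows "Q3 (kerr_ads a \<Lambda> m) (vector [t, r, \<theta>, \<phi>]) =
    (- \<Lambda> * a^4 * (cos \<theta>)^4 - 3 * a\<^sup>2 * (cos \<theta>)\<^sup>2 + \<Lambda> * a^4 * (cos \<theta>)\<^sup>2
       - \<Lambda> * a\<^sup>2 * r\<^sup>2 + 6 * a\<^sup>2 - \<Lambda> * r^4 - 6 * m * r + 3 * r\<^sup>2)
    / (6 * m * sqrt (r\<^sup>2 + a\<^sup>2 * (cos \<theta>)\<^sup>2))"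
proof -
  interpret kerr a \<Lambda> m by unfold_locales fact
  define y where "y = (vector [t, r, \<theta>, \<phi>] :: real^4)"
  have coords: "y $ 2 = r" "y $ 3 = \<theta>" by (simp_all add: y_def)
  have P: "P y = (sin \<theta>)\<^sup>2 * Delta_theta a \<Lambda> \<theta>"
    by (simp add: P_def coords Delta_theta_def sin_squared_eq)
  have "y \<in> U"
    using assms by (simp add: U_def S_def D_def P coords rho_sq_def Delta_r_def)
  then have "Q3 (kerr_ads a \<Lambda> m) y = (D y + a\<^sup>2 * P y) / (2 * m * sqrt (r\<^sup>2 + a\<^sup>2 * (cos \<theta>)\<^sup>2))"
    using assms(1) by (simp add: Q3_kerr q_def S_def coords real_sqrt_divide mult.commute)
  \<comment> \<open>The factor 3 clears the denominators \<Lambda>/3 in \<open>D\<close> and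
    \<open>P\<close>.\<close>
  also have "\<dots> = (3 * (D y + a\<^sup>2 * P y)) / (6 * m * sqrt (r\<^sup>2 + a\<^sup>2 * (cos \<theta>)\<^sup>2))"
    using mult_divide_mult_cancel_left[of 3 "D y + a\<^sup>2 * P y" "2 * m * sqrt (r\<^sup>2 + a\<^sup>2 * (cos \<theta>)\<^sup>2)"]
    by (simp only: mult.assoc[symmetric])
  also have "3 * (D y + a\<^sup>2 * P y) = - \<Lambda> * a^4 * (cos \<theta>)^4 - 3 * a\<^sup>2 * (cos \<theta>)\<^sup>2 + \<Lambda> * a^4 * (cos \<theta>)\<^sup>2
       - \<Lambda> * a\<^sup>2 * r\<^sup>2 + 6 * a\<^sup>2 - \<Lambda> * r^4 - 6 * m * r + 3 * r\<^sup>2"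
    unfolding D_def P_def coords by algebra
  finally show ?thesis by (simp add: y_def)
qed

end
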